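(* Let $BQ$ be a finite biquandle and $L$ a virtual link diagram. For every $\mathfrak{g}\in\mathbb{Z}\mathfrak{G}_{BQ}$, the integer $a_{\mathfrak{g}}(L)$ is a virtual link invariant (unchanged under generalized Reidemeister moves).
   Context: A biquandle is a set $BQ$ with binary operations $\ast,\circ$ such that: (1) $x\ast x=x\circ x$; (2) $-\ast x$ and $-\circ x$ are bijections for every $x$, and $S(x,y)=(y\circ x,x\ast y)$ is invertible; (3) $(z\circ y)\circ(x\ast y)=(z\circ x)\circ(y\circ x)$, $(y\circ x)\ast(z\circ x)=(y\ast z)\circ(x\ast z)$, $(x\ast y)\ast(z\circ y)=(x\ast z)\ast(y\ast z)$ for all $x,y,z$. Semiarcs of a virtual link diagram are the pieces from one real crossing to the next (passing through virtual crossings). A $BQ$-coloring assigns an element of $BQ$ to each semiarc so that at each real crossing: if $x$ is the label of the under-strand semiarc lying to the right of the over-strand and $y$ the label of the over-strand semiarc lying to the right of the under-strand (right taken with respect to the strand orientations), then the other under-strand semiarc is labeled $x\ast y$ and the other over-strand semiarc is labeled $y\circ x$. The weight of the crossing under the coloring is the pair $(x,y)$. $\mathfrak{G}_{BQ}$ is the group with generators $(x,y)\in BQ\times BQ$ and relations $(x,x)=1$, $(x,y)=(x\ast z,y\ast z)$, $(y,z)=(y\circ x,z\circ x)$, $(x,z)=(x\ast y,z\circ y)$ for all $x,y,z\in BQ$. The index of a real crossing $c$ is $\sum_f (x_f,y_f)\in\mathbb{Z}\mathfrak{G}_{BQ}$ (group ring), the sum over all $BQ$-colorings $f$ of $L$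 of the weight of $c$. Let $e$ be the identity of $\mathfrak{G}_{BQ}$ and $N$ the number of colorings. For $\mathfrak{g}\neq N e$, $a_{\mathfrak{g}}(L)$ is the sum of the writhes of the real crossings of index $\mathfrak{g}$; $a_{Ne}(L)$ is the sum of the writhes of the crossings of index $Ne$ minus $w(L)$, the sum of the writhes of all real crossings. *)

theory Defs
  imports Main "HOL-Library.Multiset" "HOL-Library.Poly_Mapping" "HOL-Library.FuncSet"
begin

definition biquandle :: "('q \<Rightarrow> 'q \<Rightarrow> 'q) \<Rightarrow> ('q \<Rightarrow> 'q \<Rightarrow> 'q) \<Rightarrow> bool" where
  "biquandle star circ \<longleftrightarrow>
     (\<forall>x. star x x = circ x x) \<and>
     (\<forall>x. bij (\<lambda>y. star y x)) \<and> (\<forall>x. bij (\<lambda>y. circ y x)) \<and>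
     bij (\<lambda>(x, y). (circ y x, star x y)) \<and>
     (\<forall>x y z. circ (circ z y) (star x y) = circ (circ z x) (circ y x)) \<and>
     (\<forall>x y z. star (circ y x) (circ z x) = circ (star y z) (star x z)) \<and>
     (\<forall>x y z. star (star x y) (circ z y) = star (star x z) (star y z))"

section \<open>Virtual link diagrams as signed Gauss diagrams\<close>

text \<open>A passage is (crossing label, True = over / False = under). A diagram is a list of
  components (each a cyclic list of passages in the order of traversal) together with a
  sign (writhe) function on crossing labels.\<close>

type_synonym vdiag = "(nat \<times> bool) list list \<times> (nat \<Rightarrow> int)"

definition crossings :: "vdiag \<Rightarrow> nat set" where
  "crossings D = fst ` set (concat (fst D))"

definition wf_diag :: "vdiag \<Rightarrow> bool" where
  "wf_diag D \<longleftrightarrow> (\<forall>c \<in> crossings D.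
      count_list (concat (fst D)) (c, True) = 1 \<and> count_list (concat (fst D)) (c, False) = 1 \<and>
      (snd D c = 1 \<or> snd D c = -1))"

definition adjacent :: "(nat \<times> bool) list list \<Rightarrow> nat \<times> bool \<Rightarrow> nat \<times> bool \<Rightarrow> bool" where
  "adjacent cs p q \<longleftrightarrow> (\<exists>k < length cs. \<exists>i < length (cs ! k).
      cs ! k ! i = p \<and> cs ! k ! ((i + 1) mod length (cs ! k)) = q)"

definition del_crossings :: "nat set \<Rightarrow> (nat \<times> bool) list list \<Rightarrow> (nat \<times> bool) list list" where
  "del_crossings C cs = map (filter (\<lambda>p. fst p \<notin> C)) cs"

text \<open>Changes of representation (not changing the virtual link diagram up to virtual moves).\<close>
definition iso_move :: "vdiag \<Rightarrow> vdiag \<Rightarrow> bool" where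
  "iso_move D D' \<longleftrightarrow>
     (\<exists>f. inj_on f (crossings D) \<and> (\<forall>c \<in> crossings D. snd D' (f c) = snd D c) \<and>
          fst D' = map (map (\<lambda>(c, ov). (f c, ov))) (fst D)) \<or>
     (\<exists>k n. k < length (fst D) \<and> fst D' = (fst D)[k := rotate n (fst D ! k)] \<and> snd D' = snd D) \<or>
     (mset (fst D') = mset (fst D) \<and> snd D' = snd D)"

definition R1_move :: "vdiag \<Rightarrow> vdiag \<Rightarrow> bool" where
  "R1_move D D' \<longleftrightarrow> (\<exists>c ov. adjacent (fst D) (c, ov) (c, \<not> ov) \<and>
       fst D' = del_crossings {c} (fst D) \<and> snd D' = snd D)"

definition R2_move :: "vdiag \<Rightarrow> vdiag \<Rightarrow> bool" where
  "R2_move D D' \<longleftrightarrow> (\<exists>c d. c \<noteq> d \<and> adjacent (fst D) (c, True) (d, True) \<and>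
       (adjacent (fst D) (c, False) (d, False) \<or> adjacent (fst D) (d, False) (c, False)) \<and>
       snd D c = - snd D d \<and>
       fst D' = del_crossings {c, d} (fst D) \<and> snd D' = snd D)"

definition R3_swap :: "nat \<Rightarrow> nat \<Rightarrow> nat \<Rightarrow> nat \<times> bool \<Rightarrow> nat \<times> bool" where
  "R3_swap a b c p =
     (if p = (a, True) then (b, True) else if p = (b, True) then (a, True)
      else if p = (a, False) then (c, True) else if p = (c, True) then (a, False)
      else if p = (b, False) then (c, False) else if p = (c, False) then (b, False) else p)"

text \<open>Strands T (top), M (middle), B (bottom); a = T over M, b = T over B, c = M over B.
  sT = 1 iff a precedes b on T, sM = 1 iff a precedes c on M, sB = 1 iff b precedes c on B.
  The move reverses the order of the two passages on each strand and keeps the signs.\<close>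
definition R3_move :: "vdiag \<Rightarrow> vdiag \<Rightarrow> bool" where
  "R3_move D D' \<longleftrightarrow> (\<exists>a b c sT sM sB \<Delta>::int. distinct [a, b, c] \<and>
       sT \<in> {1, -1} \<and> sM \<in> {1, -1} \<and> sB \<in> {1, -1} \<and> \<Delta> \<in> {1, -1} \<and>
       (if sT = 1 then adjacent (fst D) (a, True) (b, True) else adjacent (fst D) (b, True) (a, True)) \<and>
       (if sM = 1 then adjacent (fst D) (a, False) (c, True) else adjacent (fst D) (c, True) (a, False)) \<and>
       (if sB = 1 then adjacent (fst D) (b, False) (c, False) else adjacent (fst D) (c, False) (b, False)) \<and>
       snd D a = sT * sM * \<Delta> \<and> snd D b = sT * sB * \<Delta> \<and> snd D c = sM * sB * \<Delta> \<and>
       fst D' = map (map (R3_swap a b c)) (fst D) \<and> snd D' = snd D)"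

definition vequiv :: "vdiag \<Rightarrow> vdiag \<Rightarrow> bool" where
  "vequiv = equivclp (\<lambda>D D'. wf_diag D \<and> wf_diag D' \<and>
      (iso_move D D' \<or> R1_move D D' \<or> R2_move D D' \<or> R3_move D D'))"

text \<open>Semiarc (k, i) is the piece of component k after passage i (up to passage i+1);
  a component without passages is a single semiarc (k, 0).\<close>
definition semiarcs :: "vdiag \<Rightarrow> (nat \<times> nat) set" where
  "semiarcs D = {(k, i). k < length (fst D) \<and> i < max 1 (length (fst D ! k))}"

definition crossing_ok :: "('q \<Rightarrow> 'q \<Rightarrow> 'q) \<Rightarrow> ('q \<Rightarrow> 'q \<Rightarrow> 'q) \<Rightarrow> vdiag \<Rightarrow> (nat \<times> nat \<Rightarrow> 'q)
     \<Rightarrow> nat \<Rightarrow> nat \<times> nat \<Rightarrow> nat \<times> nat \<Rightarrow> bool" where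
  "crossing_ok star circ D f c up op =
     (let (k, i) = up; (k', j) = op; n = length (fst D ! k); n' = length (fst D ! k');
          inU = (k, (i + n - 1) mod n); outU = (k, i);
          inO = (k', (j + n' - 1) mod n'); outO = (k', j)
      in if snd D c = 1
         then f outU = star (f inU) (f outO) \<and> f inO = circ (f outO) (f inU)
         else f inU = star (f outU) (f inO) \<and> f outO = circ (f inO) (f outU))"

definition colorings :: "('q \<Rightarrow> 'q \<Rightarrow> 'q) \<Rightarrow> ('q \<Rightarrow> 'q \<Rightarrow> 'q) \<Rightarrow> vdiag \<Rightarrow> (nat \<times> nat \<Rightarrow> 'q) set" where
  "colorings star circ D = {f. f \<in> extensional (semiarcs D) \<and>
     (\<forall>c k i k' j. k < length (fst D) \<and> i < length (fst D ! k) \<and>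
        k' < length (fst D) \<and> j < length (fst D ! k') \<and>
        fst D ! k ! i = (c, False) \<and> fst D ! k' ! j = (c, True) \<longrightarrow>
        crossing_ok star circ D f c (k, i) (k', j))}"

definition pos :: "vdiag \<Rightarrow> nat \<times> bool \<Rightarrow> nat \<times> nat" where
  "pos D p = (THE q. fst q < length (fst D) \<and> snd q < length (fst D ! fst q) \<and>
                      fst D ! fst q ! snd q = p)"

definition weight :: "vdiag \<Rightarrow> (nat \<times> nat \<Rightarrow> 'q) \<Rightarrow> nat \<Rightarrow> 'q \<times> 'q" where
  "weight D f c =
     (let (k, i) = pos D (c, False); (k', j) = pos D (c, True);
          n = length (fst D ! k); n' = length (fst D ! k');
          inU = (k, (i + n - 1) mod n); outU = (k, i);
          inO = (k', (j + n' - 1) mod n'); outO = (k', j)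
      in if snd D c = 1 then (f inU, f outO) else (f outU, f inO))"

text \<open>Words: letters (generator, inverted?). The group is the quotient of words by the
  congruence generated by free reduction and deletion of relators.\<close>
type_synonym 'q gword = "(('q \<times> 'q) \<times> bool) list"

definition relators :: "('q \<Rightarrow> 'q \<Rightarrow> 'q) \<Rightarrow> ('q \<Rightarrow> 'q \<Rightarrow> 'q) \<Rightarrow> 'q gword set" where
  "relators star circ =
     {[((x, x), False)] | x. True} \<union>
     {[((x, y), False), ((star x z, star y z), True)] | x y z. True} \<union>
     {[((y, z), False), ((circ y x, circ z x), True)] | x y z. True} \<union>
     {[((x, z), False), ((star x y, circ z y), True)] | x y z. True}"

definition gstep :: "('q \<Rightarrow> 'q \<Rightarrow> 'q) \<Rightarrow> ('q \<Rightarrow> 'q \<Rightarrow> 'q) \<Rightarrow> 'q gword \<Rightarrow> 'q gword \<Rightarrow> bool" where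
  "gstep star circ u v \<longleftrightarrow>
     (\<exists>w1 w2 a b. u = w1 @ [(a, b), (a, \<not> b)] @ w2 \<and> v = w1 @ w2) \<or>
     (\<exists>w1 w2 r. r \<in> relators star circ \<and> u = w1 @ r @ w2 \<and> v = w1 @ w2)"

definition gclass :: "('q \<Rightarrow> 'q \<Rightarrow> 'q) \<Rightarrow> ('q \<Rightarrow> 'q \<Rightarrow> 'q) \<Rightarrow> 'q gword \<Rightarrow> 'q gword set" where
  "gclass star circ w = {w'. equivclp (gstep star circ) w w'}"

text \<open>Elements of the group ring Z[G_BQ] are finitely supported integer functions on G_BQ.\<close>
definition idx :: "('q \<Rightarrow> 'q \<Rightarrow> 'q) \<Rightarrow> ('q \<Rightarrow> 'q \<Rightarrow> 'q) \<Rightarrow> vdiag \<Rightarrow> nat \<Rightarrow> 'q gword set \<Rightarrow>\<^sub>0 int" where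
  "idx star circ D c =
     (\<Sum>f \<in> colorings star circ D. Poly_Mapping.single (gclass star circ [(weight D f c, False)]) 1)"

definition writhe :: "vdiag \<Rightarrow> int" where
  "writhe D = (\<Sum>c \<in> crossings D. snd D c)"

definition Ne :: "('q \<Rightarrow> 'q \<Rightarrow> 'q) \<Rightarrow> ('q \<Rightarrow> 'q \<Rightarrow> 'q) \<Rightarrow> vdiag \<Rightarrow> 'q gword set \<Rightarrow>\<^sub>0 int" where
  "Ne star circ D = Poly_Mapping.single (gclass star circ []) (int (card (colorings star circ D)))"

definition a_inv :: "('q \<Rightarrow> 'q \<Rightarrow> 'q) \<Rightarrow> ('q \<Rightarrow> 'q \<Rightarrow> 'q) \<Rightarrow> ('q gword set \<Rightarrow>\<^sub>0 int) \<Rightarrow> vdiag \<Rightarrow> int" where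
  "a_inv star circ g D =
     (\<Sum>c \<in> {c \<in> crossings D. idx star circ D c = g}. snd D c)
     - (if g = Ne star circ D then writhe D else 0)"

end

(* A coloring is determined by its colors next to the passages, up to free colors on components
without passages. In these terms every Reidemeister move replaces the conditions at the crossings
involved by other conditions, where only the colors of the semiarcs inside the kink, the bigon or
the triangle may change, and the biquandle axioms say that these inner colors exist and are unique
on both sides of the move. (Deleting a crossing amounts to imposing that the color does not change
along each of its two passages.) So corresponding colorings agree outside, and the defining
relations of the group identify the weights: all indices and the number N of colorings are
preserved. A kink has weights (x, x) and hence index N e, so its writhe is cancelled by the writhe
subtracted in a_{Ne}; the two crossings of a bigon have equal weights and opposite signs. *)
theory Submission
  imports Defs
begin

text \<open>Semiarcs are numbered by position, so a move renumbers them. The slots of the passages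
  survive, which is why colorings are traded for states. The comparison is then pure counting: two
  indices agree iff, for every class \<open>w\<close>, equally many colorings give the crossing a
  weight of class \<open>w\<close>. One count per move, made for an arbitrary predicate blind to the
  crossings of the move, yields both N and the indices of all other crossings. Deletion may leave a
  component without passages, whose color no state can see. Hence every count of states is
  multiplied by a power of the order of BQ with exponent \<open>loops\<close>. The group enters only
  through equalities between classes of generators, each obtained from a single relator; no two
  classes ever have to be shown distinct. Finiteness of BQ also serves the kink: for half of the
  choices of sign and order the inner color has to solve \<open>star v v = x\<close>. Injectivity of
  the diagonal follows from that of S, and finiteness turns it into solvability.\<close>

section \<open>Colorings as states on passages\<close>

lemma count_list_one_distinct:
  assumes "\<And>x. x \<in> set xs \<Longrightarrow> count_list xs x = 1"
  shows "distinct xs"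
  using assms
proof (induction xs)
  case (Cons a xs)
  have "a \<notin> set xs"
    using Cons.prems[of a] by (simp add: count_list_0_iff)
  moreover have "count_list xs x = 1" if "x \<in> set xs" for x
    using Cons.prems[of x] that \<open>a \<notin> set xs\<close> by (auto split: if_splits)
  ultimately show ?case using Cons.IH by simp
qed simp

lemma wf_diag_distinct:
  assumes "wf_diag D" shows "distinct (concat (fst D))"
proof (rule count_list_one_distinct)
  fix p assume p: "p \<in> set (concat (fst D))"
  obtain c ov where [simp]: "p = (c, ov)" by force
  have "c \<in> crossings D" using p unfolding crossings_def by force
  thus "count_list (concat (fst D)) p = 1"
    using assms unfolding wf_diag_def by (cases ov) auto
qed

lemma wf_diag_passage_iff:
  assumes "wf_diag D"
  shows "(c, ov) \<in> set (concat (fst D)) \<longleftrightarrow> c \<in> crossings D"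
proof
  assume "c \<in> crossings D"
  hence "count_list (concat (fst D)) (c, ov) = 1"
    using assms unfolding wf_diag_def by (cases ov) auto
  thus "(c, ov) \<in> set (concat (fst D))" by (metis count_notin zero_neq_one)
qed (force simp: crossings_def)

lemma distinct_concat_nth_unique:
  assumes "distinct (concat cs)" "k < length cs" "i < length (cs ! k)"
    "k' < length cs" "j < length (cs ! k')" "cs ! k ! i = cs ! k' ! j"
  shows "k = k' \<and> i = j"
proof -
  have "k = k'"
  proof (rule ccontr)
    assume ne: "k \<noteq> k'"
    define rest where "rest = concat (take k cs) @ concat (drop (Suc k) cs)"
    have cc: "concat cs = concat (take k cs) @ cs ! k @ concat (drop (Suc k) cs)"
      using id_take_nth_drop[OF assms(2)] by (metis concat.simps(2) concat_append)
    have "cs ! k' \<in> set (take k cs) \<union> set (drop (Suc k) cs)"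
    proof (cases "k' < k")
      case True
      thus ?thesis using assms(2) by (auto simp: in_set_conv_nth)
    next
      case False
      hence "cs ! k' = drop (Suc k) cs ! (k' - Suc k)" "k' - Suc k < length (drop (Suc k) cs)"
        using ne assms(4) by auto
      thus ?thesis using nth_mem[of "k' - Suc k" "drop (Suc k) cs"] by simp
    qed
    hence "cs ! k' ! j \<in> set (concat (take k cs)) \<union> set (concat (drop (Suc k) cs))"
      using assms(5) by (metis Un_iff concat.simps UN_I nth_mem set_concat)
    moreover have "cs ! k ! i \<in> set (cs ! k)" using assms(3) by simp
    ultimately show False using assms(1,6) unfolding cc by auto
  qed
  moreover have "distinct (cs ! k)"
    using assms(1,2) by (simp add: distinct_concat_iff)
  ultimately show ?thesis using assms by (simp add: nth_eq_iff_index_eq)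
qed

lemma in_concat_nthE:
  assumes "p \<in> set (concat cs)"
  obtains k i where "k < length cs" "i < length (cs ! k)" "cs ! k ! i = p"
  using assms by (auto simp: in_set_conv_nth)

lemma nth_nth_in_concat [simp]:
  "k < length cs \<Longrightarrow> i < length (cs ! k) \<Longrightarrow> cs ! k ! i \<in> set (concat cs)"
  by (metis UN_I nth_mem set_concat)

lemma pos_eqI:
  assumes "distinct (concat (fst D))" "k < length (fst D)" "i < length (fst D ! k)"
    "fst D ! k ! i = p"
  shows "pos D p = (k, i)"
  unfolding pos_def
  by (rule the_equality)
     (use assms distinct_concat_nth_unique[OF assms(1)] in \<open>auto simp: prod_eq_iff\<close>)

text \<open>A state records at each slot \<open>(p, False)\<close> and \<open>(p, True)\<close> the color of the semiarc
  entering and leaving the passage \<open>p\<close>. It forgets the components without passages, whose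
  semiarcs are colored freely; these are counted by \<open>loops\<close>.\<close>

definition states :: "(nat \<times> bool) list list \<Rightarrow> ((nat \<times> bool) \<times> bool \<Rightarrow> 'q) set" where
  "states cs = {t \<in> extensional (set (concat cs) \<times> UNIV).
     \<forall>p q. adjacent cs p q \<longrightarrow> t (p, True) = t (q, False)}"

lemma states_adjacentD:
  "t \<in> states cs \<Longrightarrow> adjacent cs p q \<Longrightarrow> t (p, True) = t (q, False)"
  unfolding states_def by blast

text \<open>The arguments are the under colors in and out, then the over colors in and out. The
  semiarcs to the right of the other strand are \<open>iu\<close> and \<open>oo\<close> at sign 1,
  \<open>ou\<close> and \<open>io\<close> otherwise; changing the sign exchanges in and out on both
  strands.\<close>

definition crossing_rel ::
  "('q \<Rightarrow> 'q \<Rightarrow> 'q) \<Rightarrow> ('q \<Rightarrow> 'q \<Rightarrow> 'q) \<Rightarrow> int \<Rightarrow> 'q \<Rightarrow> 'q \<Rightarrow> 'q \<Rightarrow> 'q \<Rightarrow> bool" where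
  "crossing_rel star circ s iu ou io oo \<longleftrightarrow>
     (if s = 1 then ou = star iu oo \<and> io = circ oo iu else iu = star ou io \<and> oo = circ io ou)"

definition crossing_wt :: "int \<Rightarrow> 'q \<Rightarrow> 'q \<Rightarrow> 'q \<Rightarrow> 'q \<Rightarrow> 'q \<times> 'q" where
  "crossing_wt s iu ou io oo = (if s = 1 then (iu, oo) else (ou, io))"

text \<open>The two passages are separate arguments because, once a third move is pulled back to the
  old diagram, a crossing joins passages that carry other labels.\<close>

definition ok_at :: "('q \<Rightarrow> 'q \<Rightarrow> 'q) \<Rightarrow> ('q \<Rightarrow> 'q \<Rightarrow> 'q) \<Rightarrow> int \<Rightarrow> ((nat \<times> bool) \<times> bool \<Rightarrow> 'q)
    \<Rightarrow> nat \<times> bool \<Rightarrow> nat \<times> bool \<Rightarrow> bool" where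
  "ok_at star circ s t u ov =
     crossing_rel star circ s (t (u, False)) (t (u, True)) (t (ov, False)) (t (ov, True))"

definition wt_at :: "int \<Rightarrow> ((nat \<times> bool) \<times> bool \<Rightarrow> 'q) \<Rightarrow> nat \<times> bool \<Rightarrow> nat \<times> bool \<Rightarrow> 'q \<times> 'q" where
  "wt_at s t u ov = crossing_wt s (t (u, False)) (t (u, True)) (t (ov, False)) (t (ov, True))"

definition good :: "('q \<Rightarrow> 'q \<Rightarrow> 'q) \<Rightarrow> ('q \<Rightarrow> 'q \<Rightarrow> 'q) \<Rightarrow> vdiag \<Rightarrow> ((nat \<times> bool) \<times> bool \<Rightarrow> 'q) set" where
  "good star circ D =
     {t \<in> states (fst D). \<forall>c \<in> crossings D. ok_at star circ (snd D c) t (c, False) (c, True)}"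

definition loops :: "'a list list \<Rightarrow> nat" where
  "loops cs = length (filter (\<lambda>xs. xs = []) cs)"

text \<open>Semiarc \<open>(k, i)\<close> begins at passage \<open>i\<close>, so the color entering
  a passage sits at its cyclic predecessor. Adding \<open>n\<close> before subtracting 1 keeps
  natural subtraction exact at \<open>i = 0\<close>.\<close>

definition arc_at :: "vdiag \<Rightarrow> (nat \<times> bool) \<times> bool \<Rightarrow> nat \<times> nat" where
  "arc_at D = (\<lambda>(p, s). let (k, i) = pos D p; n = length (fst D ! k)
     in (k, if s then i else (i + n - 1) mod n))"

definition trace :: "vdiag \<Rightarrow> (nat \<times> nat \<Rightarrow> 'q) \<Rightarrow> (nat \<times> bool) \<times> bool \<Rightarrow> 'q" where
  "trace D f = restrict (f \<circ> arc_at D) (set (concat (fst D)) \<times> UNIV)"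

lemma image_Collect_restr: "h ` {x \<in> A. P (h x)} = {y \<in> h ` A. P y}"
  by blast

section \<open>Colorings versus states with free colors on empty components\<close>

context
  fixes D :: vdiag
  assumes wf: "wf_diag D"
begin

lemma trace_nth:
  assumes "k < length (fst D)" "i < length (fst D ! k)"
  shows "trace D f (fst D ! k ! i, True) = f (k, i)"
    and "trace D f (fst D ! k ! i, False) =
      f (k, (i + length (fst D ! k) - 1) mod length (fst D ! k))"
  using pos_eqI[OF wf_diag_distinct[OF wf] assms refl] assms nth_nth_in_concat[OF assms]
  by (auto simp: trace_def arc_at_def Let_def simp del: set_concat)

lemma weight_trace:
  assumes "c \<in> crossings D"
  shows "weight D f c = wt_at (snd D c) (trace D f) (c, False) (c, True)"
proof -
  have "(c, ov) \<in> set (concat (fst D))" for ov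
    using assms wf_diag_passage_iff[OF wf] by blast
  thus ?thesis
    by (auto simp: weight_def wt_at_def crossing_wt_def trace_def arc_at_def Let_def
        simp del: set_concat split: prod.splits)
qed

text \<open>A crossing of a well-formed diagram has exactly one passage of each kind, so the
  quantification over positions in \<open>colorings\<close> is one over crossings.\<close>

lemma colorings_iff_trace:
  "f \<in> colorings star circ D \<longleftrightarrow> f \<in> extensional (semiarcs D) \<and>
     (\<forall>c \<in> crossings D. ok_at star circ (snd D c) (trace D f) (c, False) (c, True))"
proof -
  have "crossing_ok star circ D f c (k, i) (k', j) \<longleftrightarrow>
      ok_at star circ (snd D c) (trace D f) (c, False) (c, True)"
    if "k < length (fst D)" "i < length (fst D ! k)" "k' < length (fst D)"
      "j < length (fst D ! k')" "fst D ! k ! i = (c, False)" "fst D ! k' ! j = (c, True)"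
    for c k i k' j
    using trace_nth[OF that(1,2), of f] trace_nth[OF that(3,4), of f] that(5,6)
    by (auto simp: crossing_ok_def Let_def ok_at_def crossing_rel_def)
  note * = this
  have ex: "\<exists>k i k' j. k < length (fst D) \<and> i < length (fst D ! k) \<and> k' < length (fst D) \<and>
      j < length (fst D ! k') \<and> fst D ! k ! i = (c, False) \<and> fst D ! k' ! j = (c, True)"
    if "c \<in> crossings D" for c
    using that wf_diag_passage_iff[OF wf] in_concat_nthE by metis
  have mem: "c \<in> crossings D"
    if "k < length (fst D)" "i < length (fst D ! k)" "fst D ! k ! i = (c, False)" for c k i
    using that wf_diag_passage_iff[OF wf, of c False] nth_nth_in_concat by metis
  show ?thesis
    unfolding colorings_def mem_Collect_eq
    using * ex mem by (smt (verit))
qed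

text \<open>A semiarc of a component with passages is the leaving slot of exactly one passage. The
  semiarc of an empty component meets no slot and needs a coordinate of its own.\<close>

lemma bij_betw_trace:
  "bij_betw (\<lambda>f :: nat \<times> nat \<Rightarrow> 'q. (restrict f {(k, 0) | k. k < length (fst D) \<and> fst D ! k = []}, trace D f))
     (extensional (semiarcs D))
     (({(k, 0) | k. k < length (fst D) \<and> fst D ! k = []} \<rightarrow>\<^sub>E UNIV) \<times> states (fst D))"
  (is "bij_betw ?h _ ((?E \<rightarrow>\<^sub>E _) \<times> _)")
  unfolding bij_betw_def
proof (intro conjI set_eqI iffI)
  let ?cs = "fst D"
  show "inj_on ?h (extensional (semiarcs D))"
  proof (rule inj_onI)
    fix f f' :: "nat \<times> nat \<Rightarrow> 'q"
    assume f: "f \<in> extensional (semiarcs D)" "f' \<in> extensional (semiarcs D)"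
      and eq: "?h f = ?h f'"
    show "f = f'"
    proof (rule extensionalityI[OF f])
      fix x assume "x \<in> semiarcs D"
      then obtain k i where x: "x = (k, i)" "k < length ?cs" "i < max 1 (length (?cs ! k))"
        by (auto simp: semiarcs_def)
      show "f x = f' x"
      proof (cases "?cs ! k = []")
        case True
        hence "x \<in> ?E" using x by auto
        moreover have "restrict f ?E = restrict f' ?E" using eq by (rule Pair_inject)
        hence "restrict f ?E x = restrict f' ?E x" by (rule fun_cong)
        ultimately show ?thesis by (simp only: restrict_apply' if_True)
      next
        case False
        hence "i < length (?cs ! k)" using x(3) by (cases "?cs ! k") auto
        moreover have "trace D f = trace D f'" using eq by simp
        ultimately show ?thesis
          using trace_nth(1)[of k i f] trace_nth(1)[of k i f'] x by simp
      qed
    qed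
  qed
next
  fix y :: "(nat \<times> nat \<Rightarrow> 'q) \<times> ((nat \<times> bool) \<times> bool \<Rightarrow> 'q)"
  assume "y \<in> ?h ` extensional (semiarcs D)"
  then obtain f where y: "y = ?h f" by blast
  have "trace D f (p, True) = trace D f (q, False)" if "adjacent (fst D) p q" for p q
  proof -
    obtain k i where ki: "k < length (fst D)" "i < length (fst D ! k)" "fst D ! k ! i = p"
      "fst D ! k ! ((i + 1) mod length (fst D ! k)) = q"
      using \<open>adjacent (fst D) p q\<close> unfolding adjacent_def by blast
    let ?n = "length (fst D ! k)"
    have j: "(i + 1) mod ?n < ?n" using ki(2) by (metis gr_implies_not0 mod_less_divisor neq0_conv)
    have "((i + 1) mod ?n + ?n - 1) mod ?n = i"
    proof (cases "i + 1 = ?n")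
      case True
      thus ?thesis by simp
    next
      case False
      hence "i + 1 < ?n" using ki(2) by simp
      thus ?thesis by simp
    qed
    thus ?thesis
      using trace_nth[OF ki(1,2), of f] trace_nth[OF ki(1) j, of f] ki(3,4) by simp
  qed
  thus "y \<in> (?E \<rightarrow>\<^sub>E UNIV) \<times> states (fst D)"
    unfolding y by (auto simp: states_def trace_def)
next
  fix y :: "(nat \<times> nat \<Rightarrow> 'q) \<times> ((nat \<times> bool) \<times> bool \<Rightarrow> 'q)"
  assume "y \<in> (?E \<rightarrow>\<^sub>E UNIV) \<times> states (fst D)"
  then obtain e t where y: "y = (e, t)" and e: "e \<in> ?E \<rightarrow>\<^sub>E UNIV" and t: "t \<in> states (fst D)"
    by auto
  \<comment> \<open>The inverse reads leaving slots only; the entering slots come back through the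
    adjacency condition on \<open>t\<close>.\<close>
  define f where "f = restrict (\<lambda>(k, i). if fst D ! k = [] then e (k, i)
     else t (fst D ! k ! i, True)) (semiarcs D)"
  have "restrict f ?E = e"
    by (rule extensionalityI[of _ ?E])
       (use e in \<open>auto simp: f_def semiarcs_def PiE_def\<close>)
  moreover have "trace D f = t"
  proof (rule extensionalityI[of _ "set (concat (fst D)) \<times> UNIV"])
    fix x assume "x \<in> set (concat (fst D)) \<times> (UNIV :: bool set)"
    then obtain p s where x: "x = (p, s)" and p: "p \<in> set (concat (fst D))" by (cases x) auto
    from in_concat_nthE[OF p] obtain k i where ki: "k < length (fst D)" "i < length (fst D ! k)"
      and p_eq: "fst D ! k ! i = p" .
    let ?n = "length (fst D ! k)"
    let ?j = "(i + ?n - 1) mod ?n"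
    have j: "?j < ?n" using ki(2) by (metis gr_implies_not0 mod_less_divisor neq0_conv)
    have fk: "f (k, l) = t (fst D ! k ! l, True)" if "l < ?n" for l
      using that ki(1) by (auto simp: f_def semiarcs_def)
    have "(?j + 1) mod ?n = i"
    proof (cases i)
      case 0
      thus ?thesis using ki(2) by simp
    next
      case (Suc m)
      thus ?thesis using ki(2) by simp
    qed
    hence "adjacent (fst D) (fst D ! k ! ?j) p"
      unfolding adjacent_def using ki(1) j p_eq by metis
    hence "t (fst D ! k ! ?j, True) = t (p, False)" using t states_adjacentD by blast
    thus "trace D f x = t x"
      using trace_nth[OF ki, of f] fk[OF ki(2)] fk[OF j] p_eq x by (cases s) auto
  qed (use t in \<open>auto simp: trace_def states_def\<close>)
  moreover have "f \<in> extensional (semiarcs D)" by (simp add: f_def)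
  ultimately show "y \<in> ?h ` extensional (semiarcs D)"
    unfolding y by (intro image_eqI[of _ _ f]) auto
qed

text \<open>\<open>R\<close> stays free so that the same count gives N and every coefficient of
  every index.\<close>

lemma card_colorings_trace:
  fixes R :: "((nat \<times> bool) \<times> bool \<Rightarrow> 'q::finite) \<Rightarrow> bool"
  shows "card {f \<in> colorings star circ D. R (trace D f)} =
     card (UNIV :: 'q set) ^ loops (fst D) * card {t \<in> good star circ D. R t}"
proof -
  let ?E = "{(k, 0::nat) | k. k < length (fst D) \<and> fst D ! k = []}"
  let ?h = "\<lambda>f :: nat \<times> nat \<Rightarrow> 'q. (restrict f ?E, trace D f)"
  have "bij_betw ?h {f \<in> colorings star circ D. R (trace D f)}
      ((?E \<rightarrow>\<^sub>E UNIV) \<times> {t \<in> good star circ D. R t})"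
    using bij_betw_trace
    unfolding bij_betw_def
  proof (elim conjE, intro conjI)
    assume inj: "inj_on ?h (extensional (semiarcs D))"
      and im: "?h ` extensional (semiarcs D) = (?E \<rightarrow>\<^sub>E UNIV) \<times> states (fst D)"
    show "inj_on ?h {f \<in> colorings star circ D. R (trace D f)}"
      by (rule inj_on_subset[OF inj]) (auto simp: colorings_def)
    have "?h ` {f \<in> colorings star circ D. R (trace D f)} = ?h ` {f \<in> extensional (semiarcs D).
        R (snd (?h f)) \<and>
          (\<forall>c \<in> crossings D. ok_at star circ (snd D c) (snd (?h f)) (c, False) (c, True))}"
      unfolding colorings_iff_trace snd_conv by (rule arg_cong[where f = "(`) ?h"]) blast
    also have "\<dots> = {y \<in> ?h ` extensional (semiarcs D). R (snd y) \<and>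
          (\<forall>c \<in> crossings D. ok_at star circ (snd D c) (snd y) (c, False) (c, True))}"
      by (rule image_Collect_restr)
    also have "\<dots> = (?E \<rightarrow>\<^sub>E UNIV) \<times> {t \<in> good star circ D. R t}"
      unfolding im good_def by auto
    finally show "?h ` {f \<in> colorings star circ D. R (trace D f)} =
        (?E \<rightarrow>\<^sub>E UNIV) \<times> {t \<in> good star circ D. R t}" .
  qed
  hence "card {f \<in> colorings star circ D. R (trace D f)} =
      card (?E \<rightarrow>\<^sub>E (UNIV :: 'q set)) * card {t \<in> good star circ D. R t}"
    by (simp add: bij_betw_same_card card_cartesian_product)
  moreover have "card ?E = loops (fst D)"
  proof -
    have "?E = (\<lambda>k. (k, 0)) ` {k. k < length (fst D) \<and> fst D ! k = []}" by auto
    thus ?thesis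
      unfolding loops_def length_filter_conv_card by (simp add: card_image inj_on_def)
  qed
  moreover have "finite ?E" by simp
  ultimately show ?thesis by (simp add: card_PiE)
qed

end

section \<open>Deleting a passage\<close>

text \<open>Zipping with the rotated list closes the cycle. A one-element list yields the pair
  \<open>(p, p)\<close>, which is how a passage alone on its component is recognized.\<close>

definition cyc_pairs :: "'a list \<Rightarrow> ('a \<times> 'a) set" where
  "cyc_pairs xs = set (zip xs (rotate1 xs))"

lemma adjacent_iff_cyc_pairs: "adjacent cs p q \<longleftrightarrow> (\<exists>xs \<in> set cs. (p, q) \<in> cyc_pairs xs)"
proof -
  have "(p, q) \<in> cyc_pairs xs \<longleftrightarrow> (\<exists>i < length xs. xs ! i = p \<and> xs ! ((i + 1) mod length xs) = q)"
    for xs :: "(nat \<times> bool) list"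
    by (auto simp: cyc_pairs_def in_set_zip nth_rotate1)
  thus ?thesis
    unfolding adjacent_def by (metis in_set_conv_nth)
qed

lemma cyc_pairs_Nil [simp]: "cyc_pairs [] = {}"
  by (simp add: cyc_pairs_def)

lemma cyc_pairs_rotate1 [simp]: "cyc_pairs (rotate1 xs) = cyc_pairs xs"
proof (cases xs)
  case (Cons a ys)
  show ?thesis
  proof (cases ys)
    case Nil
    thus ?thesis by (simp add: Cons)
  next
    case (Cons b zs)
    have "zip (ys @ [a]) ((zs @ [a]) @ [b]) = zip ys (zs @ [a]) @ [(a, b)]"
      by (subst zip_append) (simp_all add: Cons)
    thus ?thesis unfolding \<open>xs = a # ys\<close> by (auto simp: cyc_pairs_def Cons)
  qed
qed simp

lemma cyc_pairs_rotate [simp]: "cyc_pairs (rotate n xs) = cyc_pairs xs"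
  by (induction n) (simp_all add: rotate_def)

lemma cyc_pairs_append_commute: "cyc_pairs (xs @ ys) = cyc_pairs (ys @ xs)"
  by (metis cyc_pairs_rotate rotate_append)

lemma cyc_pairs_subset: "cyc_pairs xs \<subseteq> set xs \<times> set xs"
  unfolding cyc_pairs_def by (auto dest: set_zip_leftD set_zip_rightD)

lemma cyc_pairs_unique:
  assumes "distinct xs"
  shows "(p, q) \<in> cyc_pairs xs \<Longrightarrow> (p, r) \<in> cyc_pairs xs \<Longrightarrow> q = r"
    and "(q, p) \<in> cyc_pairs xs \<Longrightarrow> (r, p) \<in> cyc_pairs xs \<Longrightarrow> q = r"
proof -
  show "q = r" if "(p, q) \<in> cyc_pairs xs" "(p, r) \<in> cyc_pairs xs"
    using that assms by (auto simp: cyc_pairs_def in_set_zip nth_eq_iff_index_eq)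
  have "distinct (rotate1 xs)" using assms by simp
  thus "q = r" if "(q, p) \<in> cyc_pairs xs" "(r, p) \<in> cyc_pairs xs"
    using that unfolding cyc_pairs_def by (auto simp: in_set_zip nth_eq_iff_index_eq)
qed

text \<open>Together with \<open>cyc_pairs_butlast\<close> this compares a cycle cut open at
  \<open>p\<close> with the same cycle closed up without \<open>p\<close>: the two pairs through
  \<open>p\<close> merge into one, and the rest is common.\<close>

lemma cyc_pairs_Cons:
  assumes "vs \<noteq> []"
  shows "cyc_pairs (p # vs) =
    {(p, hd vs), (last vs, p)} \<union> set (zip (butlast vs) (tl vs))"
proof -
  obtain h vs' where h: "vs = h # vs'" using assms by (cases vs) auto
  have "zip vs (vs' @ [p]) = zip (butlast vs @ [last vs]) (vs' @ [p])" using assms by simp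
  also have "\<dots> = zip (butlast vs) vs' @ [(last vs, p)]"
    using h by (subst zip_append) auto
  finally show ?thesis by (auto simp: cyc_pairs_def h)
qed

lemma cyc_pairs_butlast:
  assumes "vs \<noteq> []"
  shows "cyc_pairs vs = insert (last vs, hd vs) (set (zip (butlast vs) (tl vs)))"
proof -
  obtain h vs' where h: "vs = h # vs'" using assms by (cases vs) auto
  have "zip vs (vs' @ [h]) = zip (butlast vs @ [last vs]) (vs' @ [h])" using assms by simp
  also have "\<dots> = zip (butlast vs) vs' @ [(last vs, h)]"
    using h by (subst zip_append) auto
  finally show ?thesis by (auto simp: cyc_pairs_def h)
qed

lemma set_zip_butlast_tl: "set (zip (butlast vs) (tl vs)) \<subseteq> set vs \<times> set vs"
proof -
  have "set (butlast vs) \<subseteq> set vs" "set (tl vs) \<subseteq> set vs"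
    by (auto dest: in_set_butlastD simp: list.set_sel(2)) (cases vs, auto)
  thus ?thesis by (auto dest: set_zip_leftD) (meson set_zip_rightD subsetD)+
qed

lemma filter_neq_absent: "p \<notin> set xs \<Longrightarrow> filter (\<lambda>y. y \<noteq> p) xs = xs"
  by (rule filter_True) auto

text \<open>Rotating \<open>p\<close> to the front reduces the claim to the two descriptions just
  given. They need a nonempty rest \<open>vs\<close>, so the cycle consisting of \<open>p\<close>
  alone is treated apart.\<close>

lemma cyc_pairs_filter:
  assumes "distinct xs"
  shows "(q, r) \<in> cyc_pairs (filter (\<lambda>y. y \<noteq> p) xs) \<longleftrightarrow> q \<noteq> p \<and> r \<noteq> p \<and>
    ((q, r) \<in> cyc_pairs xs \<or> (q, p) \<in> cyc_pairs xs \<and> (p, r) \<in> cyc_pairs xs)"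
proof (cases "p \<in> set xs")
  case False
  hence "filter (\<lambda>y. y \<noteq> p) xs = xs" by (auto intro: filter_True)
  thus ?thesis using False cyc_pairs_subset[of xs] by auto
next
  case True
  then obtain ys zs where xs: "xs = ys @ p # zs" by (meson split_list)
  define vs where "vs = zs @ ys"
  have p: "p \<notin> set vs" using assms by (auto simp: xs vs_def)
  have "filter (\<lambda>y. y \<noteq> p) xs = ys @ zs"
    using p by (auto simp: xs vs_def filter_neq_absent)
  hence 1: "cyc_pairs (filter (\<lambda>y. y \<noteq> p) xs) = cyc_pairs vs"
    by (simp add: vs_def cyc_pairs_append_commute)
  have 2: "cyc_pairs xs = cyc_pairs (p # vs)"
    using cyc_pairs_append_commute[of ys "p # zs"] by (simp add: xs vs_def)
  show ?thesis
  proof (cases "vs = []")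
    case True
    thus ?thesis unfolding 1 2 by (auto simp: cyc_pairs_def)
  next
    case False
    have "set (zip (butlast vs) (tl vs)) \<subseteq> set vs \<times> set vs"
      by (rule set_zip_butlast_tl)
    moreover have "hd vs \<in> set vs" "last vs \<in> set vs" using False by auto
    ultimately show ?thesis
      using p unfolding 1 2 cyc_pairs_Cons[OF False] cyc_pairs_butlast[OF False] by blast
  qed
qed

lemma adjacent_unique:
  assumes "distinct (concat cs)"
  shows "adjacent cs p q \<Longrightarrow> adjacent cs p r \<Longrightarrow> q = r"
    and "adjacent cs q p \<Longrightarrow> adjacent cs r p \<Longrightarrow> q = r"
proof -
  have same: "xs = ys" if "xs \<in> set cs" "ys \<in> set cs" "x \<in> set xs" "x \<in> set ys" for xs ys x
    using assms that unfolding distinct_concat_iff by blast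
  have d: "distinct xs" if "xs \<in> set cs" for xs
    using assms that unfolding distinct_concat_iff by blast
  show "q = r" if "adjacent cs p q" "adjacent cs p r"
    using that unfolding adjacent_iff_cyc_pairs
    by (metis same d cyc_pairs_unique(1) cyc_pairs_subset mem_Sigma_iff subsetD)
  show "q = r" if "adjacent cs q p" "adjacent cs r p"
    using that unfolding adjacent_iff_cyc_pairs
    by (metis same d cyc_pairs_unique(2) cyc_pairs_subset mem_Sigma_iff subsetD)
qed

lemma adjacent_in_passages:
  "adjacent cs p q \<Longrightarrow> p \<in> set (concat cs) \<and> q \<in> set (concat cs)"
  unfolding adjacent_iff_cyc_pairs using cyc_pairs_subset by fastforce

lemma ex_adjacent:
  assumes "p \<in> set (concat cs)"
  shows "\<exists>q. adjacent cs p q" and "\<exists>q. adjacent cs q p"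
proof -
  obtain xs where xs: "xs \<in> set cs" "p \<in> set xs" using assms by auto
  show "\<exists>q. adjacent cs p q"
    using xs unfolding adjacent_iff_cyc_pairs cyc_pairs_def
    by (metis in_set_impl_in_set_zip1 length_rotate1)
  show "\<exists>q. adjacent cs q p"
    using xs unfolding adjacent_iff_cyc_pairs cyc_pairs_def
    by (metis in_set_impl_in_set_zip2 length_rotate1 set_rotate1)
qed

text \<open>Passages are deleted one at a time, so that only one gap has to be bridged at each
  stage, even when deleted passages are neighbors, as in a kink or a bigon.\<close>

definition del_passage :: "nat \<times> bool \<Rightarrow> (nat \<times> bool) list list \<Rightarrow> (nat \<times> bool) list list" where
  "del_passage p cs = map (filter (\<lambda>q. q \<noteq> p)) cs"

lemma concat_del_passage: "concat (del_passage p cs) = filter (\<lambda>q. q \<noteq> p) (concat cs)"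
  by (simp add: del_passage_def filter_concat)

lemma adjacent_del_passage:
  assumes "distinct (concat cs)"
  shows "adjacent (del_passage p cs) q r \<longleftrightarrow> q \<noteq> p \<and> r \<noteq> p \<and>
    (adjacent cs q r \<or> adjacent cs q p \<and> adjacent cs p r)"
proof -
  have same: "xs = ys" if "xs \<in> set cs" "ys \<in> set cs" "x \<in> set xs" "x \<in> set ys" for xs ys x
    using assms that unfolding distinct_concat_iff by blast
  have d: "distinct xs" if "xs \<in> set cs" for xs
    using assms that unfolding distinct_concat_iff by blast
  have "adjacent (del_passage p cs) q r \<longleftrightarrow>
      (\<exists>xs \<in> set cs. (q, r) \<in> cyc_pairs (filter (\<lambda>y. y \<noteq> p) xs))"
    by (auto simp: adjacent_iff_cyc_pairs del_passage_def)
  also have "\<dots> \<longleftrightarrow> (\<exists>xs \<in> set cs. q \<noteq> p \<and> r \<noteq> p \<and>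
      ((q, r) \<in> cyc_pairs xs \<or> (q, p) \<in> cyc_pairs xs \<and> (p, r) \<in> cyc_pairs xs))"
    using cyc_pairs_filter[OF d] by blast
  also have "\<dots> \<longleftrightarrow> q \<noteq> p \<and> r \<noteq> p \<and> (adjacent cs q r \<or> adjacent cs q p \<and> adjacent cs p r)"
  proof -
    \<comment> \<open>Both pairs contain \<open>p\<close>, so distinctness puts them on the same
      component.\<close>
    have "xs = ys" if "xs \<in> set cs" "ys \<in> set cs" "(q, p) \<in> cyc_pairs xs" "(p, r) \<in> cyc_pairs ys"
      for xs ys
      using same[OF that(1,2), of p] that(3,4) cyc_pairs_subset by blast
    thus ?thesis unfolding adjacent_iff_cyc_pairs by blast
  qed
  finally show ?thesis .
qed

text \<open>Only the component of \<open>p\<close> can become empty, and it does exactly when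
  \<open>p\<close> is its own successor.\<close>

lemma loops_del_passage:
  assumes "distinct (concat cs)" "p \<in> set (concat cs)"
  shows "loops (del_passage p cs) = loops cs + (if adjacent cs p p then 1 else 0)"
proof -
  obtain xs where xs: "xs \<in> set cs" "p \<in> set xs" using assms by auto
  then obtain as bs where cs: "cs = as @ xs # bs" by (meson split_list)
  have "filter (\<lambda>y. y \<noteq> p) ys = ys" if "ys \<in> set as \<union> set bs" for ys
    using assms that xs by (auto simp: cs intro!: filter_neq_absent)
  hence 1: "map (filter (\<lambda>y. y \<noteq> p)) as = as" "map (filter (\<lambda>y. y \<noteq> p)) bs = bs"
    by (simp_all add: map_idI)
  have d: "distinct xs" using assms cs by simp
  have "adjacent cs p p \<longleftrightarrow> (p, p) \<in> cyc_pairs xs"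
    using assms xs unfolding adjacent_iff_cyc_pairs distinct_concat_iff
    using cyc_pairs_subset by (metis (no_types, lifting) disjoint_iff mem_Sigma_iff subsetD)
  also have "\<dots> \<longleftrightarrow> filter (\<lambda>y. y \<noteq> p) xs = []"
  proof -
    obtain ys zs where ys: "xs = ys @ p # zs" using xs by (meson split_list)
    define vs where "vs = zs @ ys"
    have p: "p \<notin> set vs" using d by (auto simp: ys vs_def)
    have 2: "cyc_pairs xs = cyc_pairs (p # vs)"
      using cyc_pairs_append_commute[of ys "p # zs"] by (simp add: ys vs_def)
    have 3: "filter (\<lambda>y. y \<noteq> p) xs = ys @ zs"
      using p by (auto simp: ys vs_def filter_neq_absent)
    show ?thesis
    proof (cases "vs = []")
      case True
      thus ?thesis unfolding 2 3 by (auto simp: cyc_pairs_def vs_def)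
    next
      case False
      have "set (zip (butlast vs) (tl vs)) \<subseteq> set vs \<times> set vs"
        by (rule set_zip_butlast_tl)
      thus ?thesis
        using p False hd_in_set[OF False] last_in_set[OF False]
        unfolding 2 3 cyc_pairs_Cons[OF False] by (auto simp: vs_def)
    qed
  qed
  finally show ?thesis
    using xs(2) by (auto simp: loops_def del_passage_def cs 1)
qed

text \<open>If \<open>p\<close> is alone on its component, forgetting \<open>p\<close> loses the color of that
  component, and the additional loop compensates for it.\<close>

lemma card_states_del_passage:
  fixes R :: "((nat \<times> bool) \<times> bool \<Rightarrow> 'q::finite) \<Rightarrow> bool"
  assumes dist: "distinct (concat cs)" and p: "p \<in> set (concat cs)"
    and R: "\<And>t x y. R (t((p, False) := x, (p, True) := y)) = R t"
  shows "card (UNIV :: 'q set) ^ loops (del_passage p cs) * card {t \<in> states (del_passage p cs). R t}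
    = card (UNIV :: 'q set) ^ loops cs * card {t \<in> states cs. t (p, False) = t (p, True) \<and> R t}"
proof -
  let ?P = "set (concat cs)" and ?P' = "set (concat (del_passage p cs))"
  have P': "?P' = ?P - {p}" unfolding concat_del_passage by auto
  \<comment> \<open>Resetting to \<open>undefined\<close> keeps the result extensional on the
    smaller set of passages.\<close>
  let ?forget = "\<lambda>t :: (nat \<times> bool) \<times> bool \<Rightarrow> 'q. t((p, False) := undefined, (p, True) := undefined)"
  let ?set = "\<lambda>t (x :: 'q). t((p, False) := x, (p, True) := x)"
  let ?A = "{t \<in> states cs. t (p, False) = t (p, True) \<and> R t}"
  let ?A' = "{t \<in> states (del_passage p cs). R t}"
  note adj = adjacent_del_passage[OF dist, of p]
  have forget: "?forget t \<in> ?A'" if "t \<in> ?A" for t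
  proof -
    have "?forget t \<in> extensional (?P' \<times> UNIV)"
      using that unfolding P' states_def extensional_def by auto
    moreover have "?forget t (q, True) = ?forget t (r, False)" if a: "adjacent (del_passage p cs) q r" for q r
    proof -
      have "t (p, False) = t (p, True)"
        and *: "\<And>q r. adjacent cs q r \<Longrightarrow> t (q, True) = t (r, False)"
        using \<open>t \<in> ?A\<close> states_adjacentD by blast+
      moreover have "q \<noteq> p" "r \<noteq> p" "adjacent cs q r \<or> adjacent cs q p \<and> adjacent cs p r"
        using a unfolding adj by blast+
      \<comment> \<open>For a pair bridged over \<open>p\<close>, the color is handed on through the
        two equal slots of \<open>p\<close>.\<close>
      ultimately have "t (q, True) = t (r, False)" by (metis *)
      thus ?thesis using \<open>q \<noteq> p\<close> \<open>r \<noteq> p\<close> by simp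
    qed
    ultimately show ?thesis using that R unfolding states_def by blast
  qed
  have set_forget: "?set (?forget t) (t (p, True)) = t" if "t \<in> ?A" for t
    using that by (auto simp: fun_eq_iff)
  have forget_set: "?forget (?set t x) = t" if "t \<in> ?A'" for t x
    using that unfolding states_def P' extensional_def by (auto simp: fun_eq_iff)
  have set_ext: "?set t x \<in> extensional (?P \<times> UNIV)" if "t \<in> ?A'" for t x
    using that p unfolding states_def P' extensional_def by auto
  show ?thesis
  proof (cases "adjacent cs p p")
    case True
    have "?set t x \<in> ?A" if "t \<in> ?A'" for t x
    proof -
      have "?set t x (q, True) = ?set t x (r, False)" if a: "adjacent cs q r" for q r
      proof (cases "q = p \<or> r = p")
        case True
        thus ?thesis using adjacent_unique[OF dist] \<open>adjacent cs p p\<close> a by fastforce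
      next
        case False
        hence "adjacent (del_passage p cs) q r" using a adj by blast
        hence "t (q, True) = t (r, False)" using \<open>t \<in> ?A'\<close> states_adjacentD by blast
        thus ?thesis using False by simp
      qed
      thus ?thesis using set_ext[OF that] that R unfolding states_def by auto
    qed
    hence "bij_betw (\<lambda>(t, x). ?set t x) (?A' \<times> UNIV) ?A"
      using forget set_forget forget_set
      by (intro bij_betwI[where g = "\<lambda>t. (?forget t, t (p, True))"]) auto
    from bij_betw_same_card[OF this] have "card ?A = card ?A' * card (UNIV :: 'q set)"
      by (simp add: card_cartesian_product)
    thus ?thesis using True loops_del_passage[OF dist p] by simp
  next
    case False
    \<comment> \<open>Here the color at \<open>p\<close> is still visible as the color leaving the
      predecessor \<open>q0\<close>, so forgetting it loses nothing.\<close>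
    obtain q0 r0 where q0: "adjacent cs q0 p" and r0: "adjacent cs p r0"
      using ex_adjacent[OF p] by blast
    have ne: "q0 \<noteq> p" "r0 \<noteq> p" using False q0 r0 by auto
    hence a0: "adjacent (del_passage p cs) q0 r0" using q0 r0 adj by blast
    have "?set t (t (q0, True)) \<in> ?A" if "t \<in> ?A'" for t
    proof -
      have t0: "t (q0, True) = t (r0, False)" using a0 that states_adjacentD by blast
      let ?s = "?set t (t (q0, True))"
      have "?s (q, True) = ?s (r, False)" if a: "adjacent cs q r" for q r
      proof -
        consider "q = p" "r = r0" | "q = q0" "r = p" | "q \<noteq> p" "r \<noteq> p"
          using a q0 r0 adjacent_unique[OF dist] by metis
        thus ?thesis
        proof cases
          case 3
          hence "adjacent (del_passage p cs) q r" using a adj by blast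
          hence "t (q, True) = t (r, False)" using \<open>t \<in> ?A'\<close> states_adjacentD by blast
          thus ?thesis using 3 by simp
        qed (use t0 ne in auto)
      qed
      thus ?thesis using set_ext[OF that] that R unfolding states_def by auto
    qed
    moreover have "?set (?forget t) (?forget t (q0, True)) = t" if "t \<in> ?A" for t
      using set_forget[OF that] that q0 ne states_adjacentD[of t cs q0 p] by auto
    ultimately have "bij_betw (\<lambda>t. ?set t (t (q0, True))) ?A' ?A"
      using forget forget_set
      by (intro bij_betwI[where g = ?forget]) auto
    hence "card ?A' = card ?A" by (rule bij_betw_same_card)
    thus ?thesis using False loops_del_passage[OF dist p] by simp
  qed
qed

section \<open>The biquandle algebra of the Reidemeister moves\<close>

text \<open>A crossing without orientations: \<open>u0, u1\<close> are the two under semiarcs and \<open>o0, o1\<close> the two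
  over semiarcs, listed along arbitrary directions of the strands. The flag \<open>e\<close> says that \<open>u0\<close>
  lies to the right of the oriented over-strand, the flag \<open>f\<close> that \<open>o1\<close> lies to the right of
  the oriented under-strand.\<close>

definition xing :: "('q \<Rightarrow> 'q \<Rightarrow> 'q) \<Rightarrow> ('q \<Rightarrow> 'q \<Rightarrow> 'q) \<Rightarrow> bool \<Rightarrow> bool \<Rightarrow> 'q \<Rightarrow> 'q \<Rightarrow> 'q \<Rightarrow> 'q \<Rightarrow> bool" where
  "xing star circ e f u0 u1 o0 o1 \<longleftrightarrow>
     (if e then u1 else u0) = star (if e then u0 else u1) (if f then o1 else o0) \<and>
     (if f then o0 else o1) = circ (if f then o1 else o0) (if e then u0 else u1)"

definition xing_wt :: "bool \<Rightarrow> bool \<Rightarrow> 'q \<Rightarrow> 'q \<Rightarrow> 'q \<Rightarrow> 'q \<Rightarrow> 'q \<times> 'q" where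
  "xing_wt e f u0 u1 o0 o1 = ((if e then u0 else u1), (if f then o1 else o0))"

text \<open>The colors met along the three strands of a third move: \<open>t0, ti, t1\<close> on top, \<open>m0, mi, m1\<close> in
  the middle, \<open>b0, bi, b1\<close> at the bottom, the letter \<open>i\<close> marking the side of the triangle. The
  16 choices of directions and of \<open>\<Delta>\<close> in the move only enter through \<open>\<tau>\<close> = (sT \<open>\<Delta>\<close> = 1),
  \<open>\<mu>\<close> = (sM \<open>\<Delta>\<close> = 1) and \<open>\<beta>\<close> = (sB \<open>\<Delta>\<close> = 1). The triangle after the move is again a
  \<open>triangle\<close>, with all flags negated and each strand read backwards.\<close>

definition triangle :: "('q \<Rightarrow> 'q \<Rightarrow> 'q) \<Rightarrow> ('q \<Rightarrow> 'q \<Rightarrow> 'q) \<Rightarrow> bool \<Rightarrow> bool \<Rightarrow> bool \<Rightarrow>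
    'q \<Rightarrow> 'q \<Rightarrow> 'q \<Rightarrow> 'q \<Rightarrow> 'q \<Rightarrow> 'q \<Rightarrow> 'q \<Rightarrow> 'q \<Rightarrow> 'q \<Rightarrow> bool" where
  "triangle star circ \<tau> \<mu> \<beta> t0 ti t1 m0 mi m1 b0 bi b1 \<longleftrightarrow>
     xing star circ \<tau> \<mu> m0 mi t0 ti \<and> xing star circ \<tau> \<beta> b0 bi ti t1 \<and>
     xing star circ \<mu> \<beta> bi b1 mi m1"

lemma xing_flip: "xing star circ (\<not> e) (\<not> f) u1 u0 o1 o0 = xing star circ e f u0 u1 o0 o1"
  unfolding xing_def by simp

context
  fixes star circ :: "'q \<Rightarrow> 'q \<Rightarrow> 'q"
  assumes bq: "biquandle star circ"
begin

lemma star_self: "star x x = circ x x"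
  using bq unfolding biquandle_def by blast

lemma star_inj: "star y x = star z x \<longleftrightarrow> y = z"
  using bq unfolding biquandle_def bij_def inj_def by blast

lemma circ_inj: "circ y x = circ z x \<longleftrightarrow> y = z"
  using bq unfolding biquandle_def bij_def inj_def by blast

lemma ex_star: "\<exists>y. star y x = z"
proof -
  have "bij (\<lambda>y. star y x)" using bq unfolding biquandle_def by blast
  thus ?thesis by (metis bij_pointE)
qed

lemma ex_circ: "\<exists>y. circ y x = z"
proof -
  have "bij (\<lambda>y. circ y x)" using bq unfolding biquandle_def by blast
  thus ?thesis by (metis bij_pointE)
qed

lemma sideways_bij: "bij (\<lambda>(x, y). (circ y x, star x y))"
  using bq unfolding biquandle_def by blast

text \<open>At a crossing, S sends the colors of the two right-hand semiarcs to those of the two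
  left-hand ones; its inverse recovers the right from the left.\<close>

lemma sideways_inj: "circ y x = circ y' x' \<Longrightarrow> star x y = star x' y' \<Longrightarrow> x = x' \<and> y = y'"
  using injD[OF bij_is_inj[OF sideways_bij], of "(x, y)" "(x', y')"] by simp

lemma ex_sideways: "\<exists>x y. circ y x = z \<and> star x y = w"
proof -
  obtain p where "(z, w) = (\<lambda>(x, y). (circ y x, star x y)) p"
    using bij_is_surj[OF sideways_bij] unfolding surj_def by blast
  thus ?thesis by (cases p) auto
qed

lemma circ_circ: "circ (circ z y) (star x y) = circ (circ z x) (circ y x)"
  using bq unfolding biquandle_def by blast

lemma star_circ: "star (circ y x) (circ z x) = circ (star y z) (star x z)"
  using bq unfolding biquandle_def by blast

lemma star_star: "star (star x y) (circ z y) = star (star x z) (star y z)"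
  using bq unfolding biquandle_def by blast

text \<open>The known pair \<open>u0, o0\<close> consists of two right-hand colors (apply the
  operations), two left-hand colors (invert S), or one of each (invert \<open>star\<close> or
  \<open>circ\<close> in its first argument). The flags tell which.\<close>

lemma xing_unique:
  assumes "xing star circ e f u0 u1 o0 o1" "xing star circ e f u0 u1' o0 o1'"
  shows "u1 = u1' \<and> o1 = o1'"
proof (cases e; cases f)
  assume "\<not> e" "f"
  thus ?thesis using assms sideways_inj[of o1 u1 o1' u1'] unfolding xing_def by simp
qed (use assms in \<open>auto simp: xing_def star_inj circ_inj\<close>)

text \<open>The colors \<open>t0, m0\<close> determine \<open>ti, mi\<close> where T crosses M;
  \<open>b1, m1\<close> determine \<open>bi\<close> where M crosses B, read backwards.\<close>

lemma triangle_unique: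
  assumes "triangle star circ \<tau> \<mu> \<beta> t0 ti t1 m0 mi m1 b0 bi b1"
    and "triangle star circ \<tau> \<mu> \<beta> t0 ti' t1 m0 mi' m1 b0 bi' b1"
  shows "ti = ti'" and "mi = mi'" and "bi = bi'"
proof -
  show "ti = ti'" "mi = mi'"
    using assms xing_unique unfolding triangle_def by blast+
  have "xing star circ (\<not> \<mu>) (\<not> \<beta>) b1 bi m1 mi" "xing star circ (\<not> \<mu>) (\<not> \<beta>) b1 bi' m1 mi'"
    using assms unfolding triangle_def xing_flip by blast+
  thus "bi = bi'" using xing_unique by blast
qed

text \<open>The outer colors are kept. The witnesses solve some of the new crossing equations, by
  applying an operation to known colors or by inverting one; the three exchange identities yield the
  remaining equations. The hypotheses on \<open>cls\<close> are the relations of the group other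
  than \<open>(x, x) = 1\<close>.\<close>

lemma triangle_move:
  fixes cls :: "'q \<times> 'q \<Rightarrow> 'c"
  assumes cls_star: "\<And>x y z. cls (star x z, star y z) = cls (x, y)"
    and cls_circ: "\<And>x y z. cls (circ y x, circ z x) = cls (y, z)"
    and cls_mixed: "\<And>x y z. cls (star x y, circ z y) = cls (x, z)"
    and "triangle star circ \<tau> \<mu> \<beta> t0 ti t1 m0 mi m1 b0 bi b1"
  shows "\<exists>ti' mi' bi'. triangle star circ (\<not> \<tau>) (\<not> \<mu>) (\<not> \<beta>) t1 ti' t0 m1 mi' m0 b1 bi' b0 \<and>
     cls (xing_wt \<tau> \<mu> m0 mi t0 ti) = cls (xing_wt (\<not> \<tau>) (\<not> \<mu>) m1 mi' t1 ti') \<and>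
     cls (xing_wt \<tau> \<beta> b0 bi ti t1) = cls (xing_wt (\<not> \<tau>) (\<not> \<beta>) b1 bi' ti' t0) \<and>
     cls (xing_wt \<mu> \<beta> bi b1 mi m1) = cls (xing_wt (\<not> \<mu>) (\<not> \<beta>) bi' b0 mi' m0)"
    (is "\<exists>ti' mi' bi'. ?P ti' mi' bi'")
proof -
  note ax = circ_circ star_circ star_star star_inj circ_inj
  note cls = cls_star cls_circ cls_mixed
  note defs = triangle_def xing_def xing_wt_def
  show ?thesis
  proof (cases \<tau>; cases \<mu>; cases \<beta>)
    assume s: \<tau> \<mu> \<beta>
    obtain y where y: "star y t1 = m1" using ex_star by blast
    have "?P (circ t1 y) y (star b0 y)"
      using assms(4) y s unfolding defs by simp (metis ax cls)
    thus ?thesis by blast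
  next
    assume s: "\<not> \<tau>" \<mu> \<beta>
    have "?P (circ t1 m1) (star m1 t1) (star b0 (star m1 t1))"
      using assms(4) s unfolding defs by simp (metis ax cls)
    thus ?thesis by blast
  next
    assume s: "\<tau>" "\<not> \<mu>" \<beta>
    \<comment> \<open>At the new crossing of M and B both known colors \<open>m0, b0\<close> are
      left-hand ones, so the inner colors \<open>x, y\<close> come from inverting S;
      \<open>z\<close> is then forced where T crosses B.\<close>
    obtain x y where xy: "circ y x = m0" "star x y = b0" using ex_sideways by blast
    obtain z where z: "circ z x = t0" using ex_circ by blast
    have "?P z y x"
    proof -
      have "mi = circ m1 b1" "bi = star b1 m1" 
        "mi = circ (star y z) (star x z)" "bi = star (star x z) (star y z)"
        using assms(4) s xy z unfolding defs by (simp_all, metis ax)+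
      \<comment> \<open>At the old crossing of M and B the outer colors \<open>b1, m1\<close> are
        the right-hand ones. Both pairs have the same image \<open>(mi, bi)\<close> under S, so they
        coincide.\<close>
      hence "b1 = star x z" "m1 = star y z" using sideways_inj by metis+
      thus ?thesis using assms(4) xy z s unfolding defs by simp (metis ax cls)
    qed
    thus ?thesis by blast
  next
    assume s: "\<tau>" "\<mu>" "\<not> \<beta>"
    have "?P (circ t1 (circ m0 b0)) (circ m0 b0) (star b0 m0)"
      using assms(4) s unfolding defs by simp (metis ax cls)
    thus ?thesis by blast
  next
    assume s: "\<not> \<tau>" "\<not> \<mu>" "\<not> \<beta>"
    have "?P (circ t0 b1) (circ m0 (star b1 t0)) (star b1 t0)"
      using assms(4) s unfolding defs by simp (metis ax cls)
    thus ?thesis by blast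
  next
    assume s: "\<tau>" "\<not> \<mu>" "\<not> \<beta>"
    obtain x where x: "star x t0 = b1" using ex_star by blast
    have "?P (circ t0 x) (circ m0 x) x"
      using assms(4) x s unfolding defs by simp (metis ax cls)
    thus ?thesis by blast
  next
    assume s: "\<not> \<tau>" "\<mu>" "\<not> \<beta>"
    have "?P (circ t1 m1) (star m1 t1) (star b1 t0)"
      using assms(4) s unfolding defs by simp (metis ax cls)
    thus ?thesis by blast
  next
    assume s: "\<not> \<tau>" "\<not> \<mu>" "\<beta>"
    obtain z where z: "circ z b1 = t0" using ex_circ by blast
    have "?P z (star m1 z) (star b1 z)"
      using assms(4) z s unfolding defs by simp (metis ax cls)
    thus ?thesis by blast
  qed
qed

text \<open>Negating the flags and reading the strands backwards is an involution, so one
  implication gives both. \<open>P\<close> must stand under the quantifiers because the weights may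
  contain inner colors.\<close>

lemma triangle_move_iff:
  fixes cls :: "'q \<times> 'q \<Rightarrow> 'c"
  assumes cls_star: "\<And>x y z. cls (star x z, star y z) = cls (x, y)"
    and cls_circ: "\<And>x y z. cls (circ y x, circ z x) = cls (y, z)"
    and cls_mixed: "\<And>x y z. cls (star x y, circ z y) = cls (x, z)"
  shows "(\<exists>ti mi bi. triangle star circ \<tau> \<mu> \<beta> t0 ti t1 m0 mi m1 b0 bi b1 \<and>
       P (cls (xing_wt \<tau> \<mu> m0 mi t0 ti)) (cls (xing_wt \<tau> \<beta> b0 bi ti t1))
         (cls (xing_wt \<mu> \<beta> bi b1 mi m1))) \<longleftrightarrow>
    (\<exists>ti mi bi. triangle star circ (\<not> \<tau>) (\<not> \<mu>) (\<not> \<beta>) t1 ti t0 m1 mi m0 b1 bi b0 \<and>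
       P (cls (xing_wt (\<not> \<tau>) (\<not> \<mu>) m1 mi t1 ti)) (cls (xing_wt (\<not> \<tau>) (\<not> \<beta>) b1 bi ti t0))
         (cls (xing_wt (\<not> \<mu>) (\<not> \<beta>) bi b0 mi m0)))"
    (is "?L \<longleftrightarrow> ?R")
proof
  assume ?L
  thus ?R using triangle_move[OF assms] by metis
next
  assume ?R
  thus ?L using triangle_move[OF assms, of "\<not> \<tau>" "\<not> \<mu>" "\<not> \<beta>" t1 _ t0 m1 _ m0 b1 _ b0]
    unfolding not_not by metis
qed

end

text \<open>Both components of S(y, y) equal \<open>star y y\<close>, so injectivity of S makes the
  diagonal map injective, hence bijective on a finite set.\<close>

lemma ex1_star_self:
  fixes star circ :: "'q::finite \<Rightarrow> 'q \<Rightarrow> 'q"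
  assumes "biquandle star circ"
  shows "\<exists>!y. star y y = x"
proof -
  have "inj (\<lambda>y. star y y)"
  proof (rule injI)
    fix x y assume "star x x = star y y"
    moreover from this have "circ x x = circ y y" by (simp only: star_self[OF assms, symmetric])
    ultimately show "x = y" using sideways_inj[OF assms, of x x y y] by blast
  qed
  moreover from this have "surj (\<lambda>y. star y y)" by (rule finite_UNIV_inj_surj[OF finite])
  ultimately have "bij (\<lambda>y. star y y)" by (rule bijI)
  thus ?thesis unfolding bij_iff by (rule spec)
qed

text \<open>A common value of both sides has the form \<open>star w w\<close>; then S(x, y) = S(w,
  w).\<close>

lemma star_eq_circ_iff:
  fixes star circ :: "'q::finite \<Rightarrow> 'q \<Rightarrow> 'q"
  assumes "biquandle star circ"
  shows "star x y = circ y x \<longleftrightarrow> x = y"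
proof
  assume eq: "star x y = circ y x"
  obtain w where w: "star w w = star x y" using ex1_star_self[OF assms] by metis
  hence "circ w w = circ y x" using eq star_self[OF assms] by metis
  thus "x = y" using sideways_inj[OF assms] w by metis
qed (simp add: star_self[OF assms])

section \<open>Indices and local changes of states\<close>

lemma gclass_eqI:
  assumes "equivclp (gstep star circ) u v"
  shows "gclass star circ u = gclass star circ v"
  unfolding gclass_def
  using equivclp_trans[OF assms] equivclp_trans[OF equivclp_sym[OF assms]] by auto

lemma gstep_imp_gclass_eq: "gstep star circ u v \<Longrightarrow> gclass star circ u = gclass star circ v"
  by (rule gclass_eqI) (rule r_into_equivclp)

definition gen_class :: "('q \<Rightarrow> 'q \<Rightarrow> 'q) \<Rightarrow> ('q \<Rightarrow> 'q \<Rightarrow> 'q) \<Rightarrow> 'q \<times> 'q \<Rightarrow> 'q gword set" where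
  "gen_class star circ p = gclass star circ [(p, False)]"

text \<open>The word p q^-1 q reduces to p by cancellation and to q by deleting the relator.\<close>

lemma gen_class_relator:
  assumes "[(p, False), (q, True)] \<in> relators star circ"
  shows "gen_class star circ q = gen_class star circ p"
proof -
  have "gstep star circ ([(p, False)] @ [(q, True), (q, \<not> True)] @ []) ([(p, False)] @ [])"
    unfolding gstep_def by blast
  moreover have "gstep star circ ([] @ [(p, False), (q, True)] @ [(q, False)]) ([] @ [(q, False)])"
    unfolding gstep_def using assms by blast
  ultimately show ?thesis
    unfolding gen_class_def by (auto dest!: gstep_imp_gclass_eq)
qed

lemma gen_class_star: "gen_class star circ (star x z, star y z) = gen_class star circ (x, y)"
  by (rule gen_class_relator) (auto simp: relators_def)

lemma gen_class_circ: "gen_class star circ (circ y x, circ z x) = gen_class star circ (y, z)"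
  by (rule gen_class_relator) (auto simp: relators_def)

lemma gen_class_mixed: "gen_class star circ (star x y, circ z y) = gen_class star circ (x, z)"
  by (rule gen_class_relator) (auto simp: relators_def)

lemma gen_class_diag: "gen_class star circ (x, x) = gclass star circ []"
proof -
  have "gstep star circ ([] @ [((x, x), False)] @ []) ([] @ [])"
    unfolding gstep_def
    by (intro disjI2 exI[of _ "[]"] exI[of _ "[((x, x), False)]"]) (simp add: relators_def)
  thus ?thesis unfolding gen_class_def by (auto dest!: gstep_imp_gclass_eq)
qed

section \<open>Indices as counts of states\<close>

definition class_at :: "('q \<Rightarrow> 'q \<Rightarrow> 'q) \<Rightarrow> ('q \<Rightarrow> 'q \<Rightarrow> 'q) \<Rightarrow> vdiag \<Rightarrow>
    ((nat \<times> bool) \<times> bool \<Rightarrow> 'q) \<Rightarrow> nat \<Rightarrow> 'q gword set" where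
  "class_at star circ D t c = gen_class star circ (wt_at (snd D c) t (c, False) (c, True))"

lemma finite_colorings: "finite (colorings star circ D :: (nat \<times> nat \<Rightarrow> 'q::finite) set)"
proof (rule finite_subset)
  show "colorings star circ D \<subseteq> semiarcs D \<rightarrow>\<^sub>E UNIV"
    by (auto simp: colorings_def PiE_def)
  have "semiarcs D \<subseteq> (\<Union>k < length (fst D). {k} \<times> {..<max 1 (length (fst D ! k))})"
    by (auto simp: semiarcs_def)
  hence "finite (semiarcs D)" by (rule finite_subset) auto
  thus "finite (semiarcs D \<rightarrow>\<^sub>E (UNIV :: 'q set))" by (intro finite_PiE) auto
qed

text \<open>The number of colorings represented by the states in \<open>T\<close>, free colors of
  empty components included.\<close>

definition wcard :: "vdiag \<Rightarrow> ((nat \<times> bool) \<times> bool \<Rightarrow> 'q) set \<Rightarrow> nat" where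
  "wcard D T = card (UNIV :: 'q set) ^ loops (fst D) * card T"

lemma card_colorings:
  assumes "wf_diag D"
  shows "card (colorings star circ D :: (nat \<times> nat \<Rightarrow> 'q::finite) set) = wcard D (good star circ D)"
  using card_colorings_trace[OF assms, of star circ "\<lambda>_. True"] by (simp add: wcard_def)

lemma lookup_idx:
  fixes star circ :: "'q::finite \<Rightarrow> 'q \<Rightarrow> 'q"
  assumes "wf_diag D" "c \<in> crossings D"
  shows "Poly_Mapping.lookup (idx star circ D c) w =
    int (wcard D {t \<in> good star circ D. class_at star circ D t c = w})"
proof -
  have "Poly_Mapping.lookup (idx star circ D c) w =
      (\<Sum>f \<in> colorings star circ D. if gclass star circ [(weight D f c, False)] = w then 1 else 0)"
    by (simp add: idx_def lookup_sum lookup_single when_def eq_commute)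
  also have "\<dots> = int (card {f \<in> colorings star circ D. gclass star circ [(weight D f c, False)] = w})"
    by (simp add: finite_colorings sum.inter_filter[symmetric])
  also have "{f \<in> colorings star circ D. gclass star circ [(weight D f c, False)] = w} =
      {f \<in> colorings star circ D. class_at star circ D (trace D f) c = w}"
    by (simp add: weight_trace[OF assms] class_at_def gen_class_def)
  finally show ?thesis
    using card_colorings_trace[OF assms(1), of star circ "\<lambda>t. class_at star circ D t c = w"]
    by (simp add: wcard_def)
qed

lemma idx_eqI:
  fixes star circ :: "'q::finite \<Rightarrow> 'q \<Rightarrow> 'q"
  assumes "wf_diag D" "c \<in> crossings D" "wf_diag D'" "c' \<in> crossings D'"
    and "\<And>w. wcard D {t \<in> good star circ D. class_at star circ D t c = w} =
      wcard D' {t \<in> good star circ D'. class_at star circ D' t c' = w}"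
  shows "idx star circ D c = idx star circ D' c'"
  by (rule poly_mapping_eqI) (use assms in \<open>simp add: lookup_idx\<close>)

lemma Ne_eqI:
  fixes star circ :: "'q::finite \<Rightarrow> 'q \<Rightarrow> 'q"
  assumes "wf_diag D" "wf_diag D'" "wcard D (good star circ D) = wcard D' (good star circ D')"
  shows "Ne star circ D = Ne star circ D'"
  using assms by (simp add: Ne_def card_colorings)

lemma finite_crossings [simp]: "finite (crossings D)"
  by (simp add: crossings_def)

lemma a_inv_eqI:
  assumes h: "bij_betw h (crossings D) (crossings D')"
    and sign: "\<And>c. c \<in> crossings D \<Longrightarrow> snd D' (h c) = snd D c"
    and idx: "\<And>c. c \<in> crossings D \<Longrightarrow> idx star circ D c = idx star circ D' (h c)"
    and Ne: "Ne star circ D = Ne star circ D'"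
  shows "a_inv star circ g D = a_inv star circ g D'"
proof -
  have eq: "(\<Sum>c\<in>crossings D. F (idx star circ D c) (snd D c)) =
      (\<Sum>c\<in>crossings D'. F (idx star circ D' c) (snd D' c))"
    for F :: "_ \<Rightarrow> int \<Rightarrow> int"
    by (rule sum.reindex_bij_betw[OF h, THEN subst]) (simp add: sign idx)
  show ?thesis
    unfolding a_inv_def writhe_def Ne
    using eq[of "\<lambda>_ s. s"] eq[of "\<lambda>i s. if i = g then s else 0"]
    by (simp add: sum.inter_filter)
qed

text \<open>Deleting \<open>C\<close> changes the subtracted total writhe, which enters only at
  \<open>g = N e\<close>. By \<open>removed\<close>, the crossings in \<open>C\<close> contribute
  exactly the compensating amount to the sum over index \<open>g\<close>.\<close>

lemma a_inv_remove:
  assumes C: "crossings D = C \<union> crossings D'" "C \<inter> crossings D' = {}"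
    and sign: "snd D' = snd D"
    and idx: "\<And>c. c \<in> crossings D' \<Longrightarrow> idx star circ D c = idx star circ D' c"
    and Ne: "Ne star circ D = Ne star circ D'"
    and removed: "(\<Sum>c \<in> {c \<in> C. idx star circ D c = g}. snd D c) =
      (if g = Ne star circ D then \<Sum>c\<in>C. snd D c else 0)"
  shows "a_inv star circ g D = a_inv star circ g D'"
proof -
  have fin: "finite C" using C(1) finite_crossings[of D] by simp
  have "{c \<in> crossings D. idx star circ D c = g} =
      {c \<in> C. idx star circ D c = g} \<union> {c \<in> crossings D'. idx star circ D' c = g}"
    using C idx by auto
  hence "(\<Sum>c \<in> {c \<in> crossings D. idx star circ D c = g}. snd D c) =
      (\<Sum>c \<in> {c \<in> C. idx star circ D c = g}. snd D c) +
      (\<Sum>c \<in> {c \<in> crossings D'. idx star circ D' c = g}. snd D c)"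
    using C fin by (simp only:) (rule sum.union_disjoint, auto)
  moreover have "writhe D = (\<Sum>c\<in>C. snd D c) + writhe D'"
    unfolding writhe_def sign C(1) using C(2) fin by (intro sum.union_disjoint) auto
  ultimately show ?thesis
    unfolding a_inv_def Ne[symmetric] removed sign by simp
qed

text \<open>\<open>get\<close> reads the inner colors and \<open>put\<close> overwrites them.
  \<open>A t\<close> and \<open>B t\<close> are the local conditions on inner colors, given the
  outer colors of \<open>t\<close>. Each has at most one solution and both are solvable for the same
  outer colors, so exchanging solutions is a bijection.\<close>

lemma card_local_change:
  assumes put_S: "\<And>t v. t \<in> S \<Longrightarrow> put t v \<in> S"
    and get_put: "\<And>t v. get (put t v) = v"
    and put_put: "\<And>t v w. put (put t v) w = put t w"
    and put_get: "\<And>t. t \<in> S \<Longrightarrow> put t (get t) = t"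
    and A_put: "\<And>t v w. A (put t v) w = A t w"
    and B_put: "\<And>t v w. B (put t v) w = B t w"
    and R_put: "\<And>t v. R (put t v) = R t"
    and A_unique: "\<And>t v w. A t v \<Longrightarrow> A t w \<Longrightarrow> v = w"
    and B_unique: "\<And>t v w. B t v \<Longrightarrow> B t w \<Longrightarrow> v = w"
    and ex_iff: "\<And>t. (\<exists>v. A t v) \<longleftrightarrow> (\<exists>v. B t v)"
  shows "card {t \<in> S. A t (get t) \<and> R t} = card {t \<in> S. B t (get t) \<and> R t}"
proof (rule bij_betw_same_card)
  have A_the: "(THE v. A t v) = v" if "A t v" for t v
    using that A_unique by blast
  have B_the: "(THE v. B t v) = v" if "B t v" for t v
    using that B_unique by blast
  show "bij_betw (\<lambda>t. put t (THE v. B t v)) {t \<in> S. A t (get t) \<and> R t} {t \<in> S. B t (get t) \<and> R t}"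
  proof (rule bij_betwI[where g = "\<lambda>t. put t (THE v. A t v)"])
    show "(\<lambda>t. put t (THE v. B t v)) \<in>
        {t \<in> S. A t (get t) \<and> R t} \<rightarrow> {t \<in> S. B t (get t) \<and> R t}"
    proof
      fix t assume t: "t \<in> {t \<in> S. A t (get t) \<and> R t}"
      then obtain v where "B t v" using ex_iff by blast
      thus "put t (THE v. B t v) \<in> {t \<in> S. B t (get t) \<and> R t}"
        using t by (simp add: B_the put_S get_put B_put R_put)
    qed
    show "(\<lambda>t. put t (THE v. A t v)) \<in>
        {t \<in> S. B t (get t) \<and> R t} \<rightarrow> {t \<in> S. A t (get t) \<and> R t}"
    proof
      fix t assume t: "t \<in> {t \<in> S. B t (get t) \<and> R t}"
      then obtain v where "A t v" using ex_iff by blast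
      thus "put t (THE v. A t v) \<in> {t \<in> S. A t (get t) \<and> R t}"
        using t by (simp add: A_the put_S get_put A_put R_put)
    qed
  qed (auto simp: A_put B_put put_put A_the B_the put_get)
qed

text \<open>Comparing two arbitrary states, rather than a state and its update, makes the notion
  also apply to a state and its pullback in the third move.\<close>

definition supported_off :: "nat set \<Rightarrow> (((nat \<times> bool) \<times> bool \<Rightarrow> 'q) \<Rightarrow> 'b) \<Rightarrow> bool" where
  "supported_off C R \<longleftrightarrow>
     (\<forall>t t'. (\<forall>c ov s. c \<notin> C \<longrightarrow> t ((c, ov), s) = t' ((c, ov), s)) \<longrightarrow> R t = R t')"

lemma supported_off_upd:
  assumes "supported_off C R" "fst p \<in> C"
  shows "R (t((p, s) := v)) = R t"
  using assms unfolding supported_off_def by (cases p) auto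

lemma supported_off_mono: "supported_off C' R \<Longrightarrow> C \<subseteq> C' \<Longrightarrow> supported_off C R"
  unfolding supported_off_def by (meson subsetD)

lemma supported_off_conj:
  "supported_off C R \<Longrightarrow> supported_off C R' \<Longrightarrow> supported_off C (\<lambda>t. R t \<and> R' t)"
  unfolding supported_off_def by blast

lemma supported_off_ok_at:
  "C \<inter> A = {} \<Longrightarrow> supported_off C (\<lambda>t. \<forall>c \<in> A. ok_at star circ (s c) t (c, False) (c, True))"
  unfolding supported_off_def ok_at_def by (intro allI impI ball_cong) auto

lemma supported_off_class_at:
  "c \<notin> C \<Longrightarrow> supported_off C (\<lambda>t. class_at star circ D t c = w)"
  unfolding supported_off_def class_at_def wt_at_def by simp

lemma supported_off_True: "supported_off C (\<lambda>_. True)"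
  by (simp add: supported_off_def)

lemma card_states_del_crossing:
  fixes R :: "((nat \<times> bool) \<times> bool \<Rightarrow> 'q::finite) \<Rightarrow> bool"
  assumes "distinct (concat cs)" "(c, True) \<in> set (concat cs)" "(c, False) \<in> set (concat cs)"
    and R: "supported_off {c} R"
  shows "card (UNIV :: 'q set) ^ loops (del_crossings {c} cs) * card {t \<in> states (del_crossings {c} cs). R t}
    = card (UNIV :: 'q set) ^ loops cs * card {t \<in> states cs. t ((c, True), False) = t ((c, True), True) \<and>
        t ((c, False), False) = t ((c, False), True) \<and> R t}"
proof -
  let ?cs = "del_passage (c, True) cs"
  have "del_crossings {c} cs = del_passage (c, False) ?cs"
    unfolding del_crossings_def del_passage_def
    by (auto intro!: filter_cong)
  moreover have "distinct (concat ?cs)" "(c, False) \<in> set (concat ?cs)"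
    using assms unfolding concat_del_passage by auto
  ultimately show ?thesis
    using card_states_del_passage[of ?cs "(c, False)" R]
      \<comment> \<open>When the over passage is deleted, the condition at the under passage travels
        along as part of the predicate.\<close>
      card_states_del_passage[OF assms(1,2),
        of "\<lambda>t. t ((c, False), False) = t ((c, False), True) \<and> R t"]
    by (simp add: supported_off_upd[OF R])
qed

text \<open>The two updated slots are the ends of one arc, and each slot has no other partner. The
  flag \<open>s\<close> tells whether the arc runs from \<open>p\<close> to \<open>q\<close> or
  back.\<close>

lemma set_arc_states:
  assumes "distinct (concat cs)" "t \<in> states cs"
    and "if s then adjacent cs p q else adjacent cs q p"
  shows "t((p, s) := v, (q, \<not> s) := v) \<in> states cs"
proof -
  have *: "t((p, True) := v, (q, False) := v) \<in> states cs" if a: "adjacent cs p q" for p q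
  proof -
    have "(t((p, True) := v, (q, False) := v)) (x, True) =
        (t((p, True) := v, (q, False) := v)) (y, False)" if "adjacent cs x y" for x y
      using states_adjacentD[OF assms(2) that] adjacent_unique[OF assms(1)] a that by auto
    moreover have "t((p, True) := v, (q, False) := v) \<in> extensional (set (concat cs) \<times> UNIV)"
      using adjacent_in_passages[OF a] assms(2) unfolding states_def extensional_def by auto
    ultimately show ?thesis unfolding states_def by blast
  qed
  show ?thesis
    using *[of p q] *[of q p] assms(3) by (cases s) (auto simp: fun_upd_twist)
qed

section \<open>Transport of states along a relabelling of passages\<close>

definition pull :: "(nat \<times> bool \<Rightarrow> nat \<times> bool) \<Rightarrow> (nat \<times> bool) list list \<Rightarrow>
    ((nat \<times> bool) \<times> bool \<Rightarrow> 'q) \<Rightarrow> (nat \<times> bool) \<times> bool \<Rightarrow> 'q" where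
  "pull f cs t = restrict (\<lambda>(p, s). t (f p, s)) (set (concat cs) \<times> UNIV)"

lemma pull_apply: "p \<in> set (concat cs) \<Longrightarrow> pull f cs t (p, s) = t (f p, s)"
  by (simp add: pull_def)

lemma adjacent_map:
  "adjacent (map (map f) cs) x y \<longleftrightarrow> (\<exists>p q. adjacent cs p q \<and> x = f p \<and> y = f q)"
proof -
  have "cyc_pairs (map f xs) = map_prod f f ` cyc_pairs xs" for xs
    unfolding cyc_pairs_def rotate1_map zip_map_map set_map
    by (simp add: map_prod_def)
  thus ?thesis unfolding adjacent_iff_cyc_pairs by fastforce
qed

lemma bij_betw_pull:
  assumes inj: "inj_on f (set (concat cs))"
  shows "bij_betw (pull f cs) (states (map (map f) cs))
    (states cs :: ((nat \<times> bool) \<times> bool \<Rightarrow> 'q) set)"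
proof -
  let ?P = "set (concat cs)"
  have P': "set (concat (map (map f) cs)) = f ` ?P" by auto
  let ?push = "\<lambda>t :: (nat \<times> bool) \<times> bool \<Rightarrow> 'q. restrict (\<lambda>(p, s). t (inv_into ?P f p, s)) (f ` ?P \<times> UNIV)"
  show ?thesis
  proof (rule bij_betwI[where g = ?push])
    show "pull f cs \<in> states (map (map f) cs) \<rightarrow> (states cs :: ((nat \<times> bool) \<times> bool \<Rightarrow> 'q) set)"
    proof
      fix t :: "(nat \<times> bool) \<times> bool \<Rightarrow> 'q" assume t: "t \<in> states (map (map f) cs)"
      have "pull f cs t (p, True) = pull f cs t (q, False)" if "adjacent cs p q" for p q
        using adjacent_in_passages[OF that] states_adjacentD[OF t, of "f p" "f q"] that
        unfolding adjacent_map by (metis pull_apply)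
      moreover have "pull f cs t \<in> extensional (?P \<times> UNIV)" by (simp add: pull_def)
      ultimately show "pull f cs t \<in> states cs" unfolding states_def by blast
    qed
    show "?push \<in> states cs \<rightarrow> states (map (map f) cs)"
    proof
      fix t :: "(nat \<times> bool) \<times> bool \<Rightarrow> 'q" assume t: "t \<in> states cs"
      have "?push t (f p, True) = ?push t (f q, False)" if "adjacent cs p q" for p q
        using adjacent_in_passages[OF that] states_adjacentD[OF t that] inj
        by (simp del: set_concat)
      moreover have "?push t \<in> extensional (f ` ?P \<times> UNIV)" by simp
      ultimately show "?push t \<in> states (map (map f) cs)"
        unfolding states_def P' adjacent_map by blast
    qed
    fix t :: "(nat \<times> bool) \<times> bool \<Rightarrow> 'q" assume t: "t \<in> states (map (map f) cs)"
    show "?push (pull f cs t) = t"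
      by (rule extensionalityI[of _ "f ` ?P \<times> UNIV"])
         (use t inj in \<open>auto simp: states_def P' pull_apply simp del: set_concat\<close>)
  next
    fix t :: "(nat \<times> bool) \<times> bool \<Rightarrow> 'q" assume t: "t \<in> states cs"
    show "pull f cs (?push t) = t"
      by (rule extensionalityI[of _ "?P \<times> UNIV"])
         (use t inj in \<open>auto simp: states_def pull_def simp del: set_concat\<close>)
  qed
qed

lemma card_pull:
  assumes "inj_on f (set (concat cs))"
    and "\<And>t. t \<in> states (map (map f) cs) \<Longrightarrow> R' t = R (pull f cs t)"
  shows "card {t \<in> states (map (map f) cs). R' t} = card {t \<in> states cs. R t}"
proof (rule bij_betw_same_card)
  have "{t \<in> states (map (map f) cs). R' t} = {t \<in> states (map (map f) cs). R (pull f cs t)}"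
    using assms(2) by blast
  thus "bij_betw (pull f cs) {t \<in> states (map (map f) cs). R' t} {t \<in> states cs. R t}"
    using bij_betw_pull[OF assms(1)] image_Collect_restr[of "pull f cs" "states (map (map f) cs)" R]
    unfolding bij_betw_def by (auto intro: inj_on_subset)
qed

lemma loops_map [simp]: "loops (map (map f) cs) = loops cs"
  by (simp add: loops_def filter_map o_def)

section \<open>Moves I and II\<close>

lemma crossings_del:
  assumes "fst D' = del_crossings C (fst D)"
  shows "crossings D' = crossings D - C"
  unfolding crossings_def assms del_crossings_def by (force simp: filter_concat[symmetric])

text \<open>The inner arc \<open>v\<close> is on the right of both strands or on the left of both.
  In the first case both outer colors equal \<open>star v v = circ v v\<close>. In the second,
  \<open>v\<close> is at once \<open>star\<close> and \<open>circ\<close> of the outer colors, which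
  forces these to agree by \<open>star_eq_circ_iff\<close>.\<close>

lemma kink_iff:
  fixes star circ :: "'q::finite \<Rightarrow> 'q \<Rightarrow> 'q"
  assumes "biquandle star circ"
  shows "(if ov then crossing_rel star circ s v x' x v else crossing_rel star circ s x v v x') \<longleftrightarrow>
    x' = x \<and> (if (s = 1) = ov then star v v = x else v = star x x)"
  unfolding crossing_rel_def
  using star_eq_circ_iff[OF assms] star_self[OF assms] by (auto; metis)

lemma ok_at_kink:
  "ok_at star circ s t (c, False) (c, True) \<longleftrightarrow>
    (if ov then crossing_rel star circ s (t ((c, \<not> ov), False)) (t ((c, \<not> ov), True))
        (t ((c, ov), False)) (t ((c, ov), True))
      else crossing_rel star circ s (t ((c, ov), False)) (t ((c, ov), True))
        (t ((c, \<not> ov), False)) (t ((c, \<not> ov), True)))"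
  by (simp add: ok_at_def)

lemma wcard_R1:
  fixes star circ :: "'q::finite \<Rightarrow> 'q \<Rightarrow> 'q" and R :: "((nat \<times> bool) \<times> bool \<Rightarrow> 'q) \<Rightarrow> bool"
  assumes bq: "biquandle star circ" and wf: "wf_diag D"
    and adj: "adjacent (fst D) (c, ov) (c, \<not> ov)"
    and D': "fst D' = del_crossings {c} (fst D)" "snd D' = snd D"
    and R: "supported_off {c} R"
  shows "wcard D {t \<in> good star circ D. R t} = wcard D' {t \<in> good star circ D'. R t}"
proof -
  let ?S = "states (fst D) :: ((nat \<times> bool) \<times> bool \<Rightarrow> 'q) set"
  let ?p = "(c, ov)" and ?q = "(c, \<not> ov)"
  note dist = wf_diag_distinct[OF wf]
  have c: "c \<in> crossings D"
    using adjacent_in_passages[OF adj] wf_diag_passage_iff[OF wf] by blast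
  hence pc: "(c, ov') \<in> set (concat (fst D))" for ov'
    using wf_diag_passage_iff[OF wf] by blast
  have crs: "crossings D' = crossings D - {c}" by (rule crossings_del[OF D'(1)])
  define R' where "R' t \<longleftrightarrow>
    (\<forall>d \<in> crossings D'. ok_at star circ (snd D d) t (d, False) (d, True)) \<and> R t" for t
  have R': "supported_off {c} R'"
    unfolding R'_def using R by (intro supported_off_conj supported_off_ok_at) (auto simp: crs)
  \<comment> \<open>\<open>A\<close> is the condition that remains after deletion, \<open>B\<close>
    the one imposed by the kink; \<open>v\<close> is the color of the inner arc.\<close>
  define A where "A t v \<longleftrightarrow> t (?p, False) = v \<and> v = t (?q, True)"
    for t :: "(nat \<times> bool) \<times> bool \<Rightarrow> 'q" and v
  define B where "B t v \<longleftrightarrow> (if ov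
      then crossing_rel star circ (snd D c) v (t (?q, True)) (t (?p, False)) v
      else crossing_rel star circ (snd D c) (t (?p, False)) v v (t (?q, True)))"
    for t :: "(nat \<times> bool) \<times> bool \<Rightarrow> 'q" and v
  have eq: "t (?p, True) = t (?q, False)" if "t \<in> ?S" for t
    using states_adjacentD[OF that adj] .
  have "{t \<in> good star circ D. R t} = {t \<in> ?S. B t (t (?p, True)) \<and> R' t}"
  proof -
    have "ok_at star circ (snd D c) t (c, False) (c, True) \<longleftrightarrow> B t (t (?p, True))" if "t \<in> ?S" for t
      unfolding B_def using eq[OF that] ok_at_kink[of star circ "snd D c" t c ov] by auto
    moreover have "(\<forall>d \<in> crossings D. P d) \<longleftrightarrow> P c \<and> (\<forall>d \<in> crossings D'. P d)" for P
      using c unfolding crs by blast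
    ultimately show ?thesis unfolding good_def R'_def by (auto simp only: mem_Collect_eq)
  qed
  also have "card \<dots> = card {t \<in> ?S. A t (t (?p, True)) \<and> R' t}"
  proof (rule card_local_change[where put = "\<lambda>t v. t((?p, True) := v, (?q, False) := v)"
        and get = "\<lambda>t. t (?p, True)" and A = B and B = A])
    show "t((?p, True) := v, (?q, False) := v) \<in> ?S" if "t \<in> ?S" for t v
      using set_arc_states[OF dist that, of True ?p ?q v] adj by simp
    show "t((?p, True) := t (?p, True), (?q, False) := t (?p, True)) = t" if "t \<in> ?S" for t
      using eq[OF that] by (auto simp: fun_eq_iff)
    show "R' (t((?p, True) := v, (?q, False) := v)) = R' t" for t v
      by (simp add: supported_off_upd[OF R'])
    show "v = w" if "B t v" "B t w" for t v w
    proof -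
      have "v = w" if "star v v = star w w" for v w
        using ex1_star_self[OF bq] that by blast
      thus ?thesis using that unfolding B_def kink_iff[OF bq] by (metis (full_types))
    qed
    show "(\<exists>v. B t v) \<longleftrightarrow> (\<exists>v. A t v)" for t
    proof -
      \<comment> \<open>This is the inner color when it lies on the right; on the left it is given
        explicitly.\<close>
      obtain w where "star w w = t (?p, False)" using ex1_star_self[OF bq] by blast
      thus ?thesis unfolding A_def B_def kink_iff[OF bq] by auto
    qed
    show "t((?p, True) := v, (?q, False) := v, (?p, True) := w, (?q, False) := w) =
        t((?p, True) := w, (?q, False) := w)" for t :: "(nat \<times> bool) \<times> bool \<Rightarrow> 'q" and v w
      by (rule ext) simp
    show "A (t((?p, True) := v, (?q, False) := v)) w = A t w" for t v w
      by (simp add: A_def)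
    show "B (t((?p, True) := v, (?q, False) := v)) w = B t w" for t v w
      by (simp add: B_def)
    show "v = w" if "A t v" "A t w" for t v w
      using that unfolding A_def by (elim conjE) (rule trans[OF sym])
  qed simp
  also have "{t \<in> ?S. A t (t (?p, True)) \<and> R' t} = {t \<in> ?S.
      t ((c, True), False) = t ((c, True), True) \<and> t ((c, False), False) = t ((c, False), True) \<and> R' t}"
  proof (rule Collect_cong, rule conj_cong[OF refl])
    show "A t (t (?p, True)) \<and> R' t \<longleftrightarrow> t ((c, True), False) = t ((c, True), True) \<and>
        t ((c, False), False) = t ((c, False), True) \<and> R' t" if "t \<in> ?S" for t
      using eq[OF that] unfolding A_def by (cases ov) auto
  qed
  finally show ?thesis
    using card_states_del_crossing[OF dist pc pc R']
    by (simp add: wcard_def D' good_def R'_def conj_assoc)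
qed

lemma a_inv_R1:
  fixes star circ :: "'q::finite \<Rightarrow> 'q \<Rightarrow> 'q"
  assumes bq: "biquandle star circ" and wf: "wf_diag D" "wf_diag D'" and "R1_move D D'"
  shows "a_inv star circ g D = a_inv star circ g D'"
proof -
  obtain c ov where adj: "adjacent (fst D) (c, ov) (c, \<not> ov)"
    and D': "fst D' = del_crossings {c} (fst D)" "snd D' = snd D"
    using \<open>R1_move D D'\<close> unfolding R1_move_def by blast
  have c: "c \<in> crossings D"
    using adjacent_in_passages[OF adj] wf_diag_passage_iff[OF wf(1)] by blast
  have crs: "crossings D' = crossings D - {c}" by (rule crossings_del[OF D'(1)])
  note count = wcard_R1[OF bq wf(1) adj D']
  have Ne: "Ne star circ D = Ne star circ D'"
    using count[OF supported_off_True] by (intro Ne_eqI wf) simp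
  have "class_at star circ D t c = gclass star circ []" if t: "t \<in> good star circ D" for t
  proof -
    have "ok_at star circ (snd D c) t (c, False) (c, True)" using t c unfolding good_def by blast
    moreover have "t ((c, ov), True) = t ((c, \<not> ov), False)"
      using t adj states_adjacentD unfolding good_def by blast
    ultimately have "\<exists>x. wt_at (snd D c) t (c, False) (c, True) = (x, x)"
      using kink_iff[OF bq, of ov "snd D c" "t ((c, ov), True)" "t ((c, \<not> ov), True)" "t ((c, ov), False)"]
      unfolding ok_at_kink[of _ _ _ _ _ ov] by (auto simp: wt_at_def crossing_wt_def split: if_splits)
    thus ?thesis unfolding class_at_def using gen_class_diag by metis
  qed
  hence "{t \<in> good star circ D. class_at star circ D t c = w} =
      (if gclass star circ [] = w then good star circ D else {})" for w
    by auto
  hence idx_c: "idx star circ D c = Ne star circ D"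
    by (intro poly_mapping_eqI)
      (simp add: lookup_idx[OF wf(1) c] Ne_def card_colorings[OF wf(1)] lookup_single when_def
        wcard_def)
  show ?thesis
  proof (intro a_inv_remove[where C = "{c}"] Ne)
    show "idx star circ D d = idx star circ D' d" if "d \<in> crossings D'" for d
    proof (rule idx_eqI)
      fix w
      have "supported_off {c} (\<lambda>t. class_at star circ D t d = w)"
        using that crs by (intro supported_off_class_at) auto
      from count[OF this] show "wcard D {t \<in> good star circ D. class_at star circ D t d = w} =
          wcard D' {t \<in> good star circ D'. class_at star circ D' t d = w}"
        by (simp add: class_at_def D')
    qed (use wf that crs in auto)
    have "{d \<in> {c}. idx star circ D d = g} = (if g = Ne star circ D then {c} else {})"
      using idx_c by auto
    thus "(\<Sum>d \<in> {d \<in> {c}. idx star circ D d = g}. snd D d) =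
        (if g = Ne star circ D then \<Sum>d\<in>{c}. snd D d else 0)"
      by simp
  qed (use c crs D' in auto)
qed

section \<open>The second move, with parallel or antiparallel strands\<close>

lemma ex_crossing_rel:
  assumes "biquandle star circ"
  shows "\<exists>v y. crossing_rel star circ s u v x y"
    and "\<exists>v y. crossing_rel star circ s v u x y"
proof -
  obtain y where "circ y u = x" using ex_circ[OF assms] by blast
  moreover obtain v where "star v x = u" using ex_star[OF assms] by blast
  ultimately show "\<exists>v y. crossing_rel star circ s u v x y"
    unfolding crossing_rel_def by (metis (full_types))
  obtain v' y' where "circ y' v' = x" "star v' y' = u" using ex_sideways[OF assms] by blast
  thus "\<exists>v y. crossing_rel star circ s v u x y"
    unfolding crossing_rel_def by (cases "s = 1") auto
qed

lemma crossing_rel_unique: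
  assumes "biquandle star circ"
  shows "crossing_rel star circ s u v x y \<Longrightarrow> crossing_rel star circ s u v' x y' \<Longrightarrow> y = y' \<and> v = v'"
    and "crossing_rel star circ s v u x y \<Longrightarrow> crossing_rel star circ s v' u x y' \<Longrightarrow> y = y' \<and> v = v'"
proof -
  show "y = y' \<and> v = v'"
    if "crossing_rel star circ s u v x y" "crossing_rel star circ s u v' x y'"
    using that circ_inj[OF assms] star_inj[OF assms] unfolding crossing_rel_def
    by (metis (full_types))
  show "y = y' \<and> v = v'"
    if "crossing_rel star circ s v u x y" "crossing_rel star circ s v' u x y'"
    using that sideways_inj[OF assms, of y v y' v'] unfolding crossing_rel_def
    by (cases "s = 1") auto
qed

text \<open>A relation of sign \<open>-s\<close> is one of sign \<open>s\<close> with in and out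
  exchanged. So both crossings state the same relation around the same inner colors
  \<open>v, y\<close>, and the outer colors at the two ends must match. \<open>dir\<close> says that
  the strands are parallel.\<close>

lemma bigon_iff:
  assumes bq: "biquandle star circ" and s: "s = 1 \<or> s = -1"
  shows "(if dir then crossing_rel star circ s u v x y \<and> crossing_rel star circ (-s) v w y z
      else crossing_rel star circ s v w x y \<and> crossing_rel star circ (-s) u v y z) \<longleftrightarrow>
    w = u \<and> z = x \<and> (if dir then crossing_rel star circ s u v x y else crossing_rel star circ s v u x y)"
proof -
  \<comment> \<open>This is the antiparallel case with \<open>s = -1\<close>, where the outer colors
    are the right-hand ones and S must be inverted.\<close>
  have "w = u \<and> z = x" if "y = circ x w" "v = star w x" "y = circ z u" "v = star u z"
    using sideways_inj[OF bq, of x w z u] that by auto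
  thus ?thesis
    using s circ_inj[OF bq] star_inj[OF bq] unfolding crossing_rel_def
    by (cases dir) auto
qed

lemma card_states_del_two_crossings:
  fixes R :: "((nat \<times> bool) \<times> bool \<Rightarrow> 'q::finite) \<Rightarrow> bool"
  assumes dist: "distinct (concat cs)" and ne: "c \<noteq> d"
    and mem: "\<And>ov. (c, ov) \<in> set (concat cs)" "\<And>ov. (d, ov) \<in> set (concat cs)"
    and R: "supported_off {c, d} R"
  shows "card (UNIV :: 'q set) ^ loops (del_crossings {c, d} cs) *
      card {t \<in> states (del_crossings {c, d} cs). R t} =
    card (UNIV :: 'q set) ^ loops cs * card {t \<in> states cs.
      (t ((c, True), False) = t ((c, True), True) \<and> t ((c, False), False) = t ((c, False), True)) \<and>
      (t ((d, True), False) = t ((d, True), True) \<and> t ((d, False), False) = t ((d, False), True)) \<and> R t}"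
proof -
  let ?cs = "del_crossings {c} cs"
  have "concat ?cs = filter (\<lambda>p. fst p \<notin> {c}) (concat cs)"
    unfolding del_crossings_def filter_concat ..
  hence "distinct (concat ?cs)" "(d, ov) \<in> set (concat ?cs)" for ov
    using dist mem ne by auto
  moreover have "del_crossings {c, d} cs = del_crossings {d} ?cs"
    unfolding del_crossings_def by (auto intro!: filter_cong)
  moreover have "supported_off {d} R" using supported_off_mono[OF R] by blast
  moreover have "supported_off {c} (\<lambda>t. t ((d, True), False) = t ((d, True), True) \<and>
      t ((d, False), False) = t ((d, False), True) \<and> R t)"
  proof (intro supported_off_conj)
    show "supported_off {c} R" using supported_off_mono[OF R] by blast
  qed (use ne in \<open>simp_all add: supported_off_def\<close>)
  ultimately show ?thesis
    using card_states_del_crossing[of ?cs d R] card_states_del_crossing[OF dist mem(1,1)]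
    by (simp add: conj_assoc)
qed

lemma wcard_R2:
  fixes star circ :: "'q::finite \<Rightarrow> 'q \<Rightarrow> 'q" and R :: "((nat \<times> bool) \<times> bool \<Rightarrow> 'q) \<Rightarrow> bool"
  assumes bq: "biquandle star circ" and wf: "wf_diag D" and ne: "c \<noteq> d"
    and adjT: "adjacent (fst D) (c, True) (d, True)"
    and adjF: "if dir then adjacent (fst D) (c, False) (d, False)
      else adjacent (fst D) (d, False) (c, False)"
    and sign: "snd D d = - snd D c"
    and D': "fst D' = del_crossings {c, d} (fst D)" "snd D' = snd D"
    and R: "supported_off {c, d} R"
  shows "wcard D {t \<in> good star circ D. R t} = wcard D' {t \<in> good star circ D'. R t}"
proof -
  let ?S = "states (fst D) :: ((nat \<times> bool) \<times> bool \<Rightarrow> 'q) set"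
  \<comment> \<open>The inner under arc runs from \<open>p\<close> to \<open>q\<close>, whichever
    crossing the under strand meets first.\<close>
  define p where "p = (if dir then c else d, False)"
  define q where "q = (if dir then d else c, False)"
  let ?c = "(c, True)" and ?d = "(d, True)"
  note dist = wf_diag_distinct[OF wf]
  have adj: "adjacent (fst D) p q" using adjF by (auto simp: p_def q_def)
  have mem: "c \<in> crossings D" "d \<in> crossings D"
    using adjacent_in_passages[OF adjT] wf_diag_passage_iff[OF wf] by blast+
  hence pc: "(c, ov) \<in> set (concat (fst D))" "(d, ov) \<in> set (concat (fst D))" for ov
    using wf_diag_passage_iff[OF wf] by blast+
  have s: "snd D c = 1 \<or> snd D c = -1" using wf mem unfolding wf_diag_def by blast
  have crs: "crossings D' = crossings D - {c, d}" by (rule crossings_del[OF D'(1)])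
  define R' where "R' t \<longleftrightarrow>
    (\<forall>e \<in> crossings D'. ok_at star circ (snd D e) t (e, False) (e, True)) \<and> R t" for t
  have R': "supported_off {c, d} R'"
    unfolding R'_def using R by (intro supported_off_conj supported_off_ok_at) (auto simp: crs)
  \<comment> \<open>The unknown \<open>w\<close> is the pair of inner colors, first over, then
    under.\<close>
  define A where "A t w \<longleftrightarrow> (t (?c, False) = fst w \<and> t (p, False) = snd w) \<and>
      (t (?d, True) = fst w \<and> t (q, True) = snd w)"
    for t :: "(nat \<times> bool) \<times> bool \<Rightarrow> 'q" and w
  define B where "B t w \<longleftrightarrow> (if dir
      then crossing_rel star circ (snd D c) (t (p, False)) (snd w) (t (?c, False)) (fst w) \<and>
        crossing_rel star circ (- snd D c) (snd w) (t (q, True)) (fst w) (t (?d, True))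
      else crossing_rel star circ (snd D c) (snd w) (t (q, True)) (t (?c, False)) (fst w) \<and>
        crossing_rel star circ (- snd D c) (t (p, False)) (snd w) (fst w) (t (?d, True)))"
    for t :: "(nat \<times> bool) \<times> bool \<Rightarrow> 'q" and w
  note B_iff = B_def[unfolded bigon_iff[OF bq s]]
  let ?get = "\<lambda>t :: (nat \<times> bool) \<times> bool \<Rightarrow> 'q. (t (?c, True), t (p, True))"
  let ?put = "\<lambda>(t :: (nat \<times> bool) \<times> bool \<Rightarrow> 'q) w.
    t((?c, True) := fst w, (?d, False) := fst w, (p, True) := snd w, (q, False) := snd w)"
  have eq: "t (?c, True) = t (?d, False)" "t (p, True) = t (q, False)" if "t \<in> ?S" for t
    using states_adjacentD[OF that adjT] states_adjacentD[OF that adj] .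
  have slots: "p \<noteq> q" "p \<noteq> ?c" "p \<noteq> ?d" "q \<noteq> ?c" "q \<noteq> ?d" "?c \<noteq> ?d"
    using ne by (auto simp: p_def q_def)
  have pq: "fst p \<in> {c, d}" "fst q \<in> {c, d}" by (auto simp: p_def q_def)
  have "{t \<in> good star circ D. R t} = {t \<in> ?S. B t (?get t) \<and> R' t}"
  proof -
    have "ok_at star circ (snd D c) t (c, False) (c, True) \<and>
        ok_at star circ (snd D d) t (d, False) (d, True) \<longleftrightarrow> B t (?get t)" if "t \<in> ?S" for t
      unfolding B_def ok_at_def sign using eq[OF that] by (auto simp: p_def q_def)
    moreover have "(\<forall>e \<in> crossings D. P e) \<longleftrightarrow> (P c \<and> P d) \<and> (\<forall>e \<in> crossings D'. P e)" for P
      using mem unfolding crs by blast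
    ultimately show ?thesis unfolding good_def R'_def by (auto simp only: mem_Collect_eq)
  qed
  also have "card \<dots> = card {t \<in> ?S. A t (?get t) \<and> R' t}"
  proof (rule card_local_change[where put = ?put and get = ?get and A = B and B = A])
    show "?put t w \<in> ?S" if "t \<in> ?S" for t w
      using set_arc_states[OF dist set_arc_states[OF dist that, of True ?c ?d "fst w"],
          of True p q "snd w"] adj adjT by simp
    show "?put t (?get t) = t" if "t \<in> ?S" for t
      using eq[OF that] by (auto simp: fun_eq_iff)
    show "R' (?put t w) = R' t" for t w
      by (simp add: supported_off_upd[OF R'] pq[simplified])
    show "v = w" if "B t v" "B t w" for t v w
      using that crossing_rel_unique[OF bq, of "snd D c"] unfolding B_iff prod_eq_iff
      by (metis (full_types))
    show "(\<exists>v. B t v) \<longleftrightarrow> (\<exists>v. A t v)" for t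
    proof -
      have "\<exists>w. if dir
          then crossing_rel star circ (snd D c) (t (p, False)) (snd w) (t (?c, False)) (fst w)
          else crossing_rel star circ (snd D c) (snd w) (t (p, False)) (t (?c, False)) (fst w)"
        using ex_crossing_rel[OF bq, of "snd D c" "t (p, False)" "t (?c, False)"] by auto
      thus ?thesis unfolding A_def B_iff by (auto split del: if_split)
    qed
    show "?put (?put t v) w = ?put t w" for t v w
      by (rule ext) simp
    show "A (?put t v) w = A t w" for t v w
      using slots by (simp add: A_def)
    show "B (?put t v) w = B t w" for t v w
      using slots by (simp add: B_def)
    show "v = w" if "A t v" "A t w" for t v w
      using that unfolding A_def prod_eq_iff by metis
  qed (use slots in simp)
  also have "{t \<in> ?S. A t (?get t) \<and> R' t} = {t \<in> ?S.
      (t ((c, True), False) = t ((c, True), True) \<and> t ((c, False), False) = t ((c, False), True)) \<and>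
      (t ((d, True), False) = t ((d, True), True) \<and> t ((d, False), False) = t ((d, False), True)) \<and> R' t}"
  proof (rule Collect_cong, rule conj_cong[OF refl])
    show "A t (?get t) \<and> R' t \<longleftrightarrow>
      (t ((c, True), False) = t ((c, True), True) \<and> t ((c, False), False) = t ((c, False), True)) \<and>
      (t ((d, True), False) = t ((d, True), True) \<and> t ((d, False), False) = t ((d, False), True)) \<and> R' t"
      if "t \<in> ?S" for t
      using eq[OF that] unfolding A_def by (cases dir) (auto simp: p_def q_def)
  qed
  finally show ?thesis
    using card_states_del_two_crossings[OF dist ne pc R']
    by (simp add: wcard_def D' good_def R'_def conj_assoc)
qed

lemma a_inv_R2:
  fixes star circ :: "'q::finite \<Rightarrow> 'q \<Rightarrow> 'q"
  assumes bq: "biquandle star circ" and wf: "wf_diag D" "wf_diag D'" and "R2_move D D'"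
  shows "a_inv star circ g D = a_inv star circ g D'"
proof -
  obtain c d where ne: "c \<noteq> d" and adjT: "adjacent (fst D) (c, True) (d, True)"
    and adjF': "adjacent (fst D) (c, False) (d, False) \<or> adjacent (fst D) (d, False) (c, False)"
    and sign': "snd D c = - snd D d"
    and D': "fst D' = del_crossings {c, d} (fst D)" "snd D' = snd D"
    using \<open>R2_move D D'\<close> unfolding R2_move_def by blast
  obtain dir where adjF: "if dir then adjacent (fst D) (c, False) (d, False)
      else adjacent (fst D) (d, False) (c, False)"
    using adjF' by (metis (full_types))
  have sign: "snd D d = - snd D c" using sign' by simp
  have mem: "c \<in> crossings D" "d \<in> crossings D"
    using adjacent_in_passages[OF adjT] wf_diag_passage_iff[OF wf(1)] by blast+
  have s: "snd D c = 1 \<or> snd D c = -1" using wf(1) mem unfolding wf_diag_def by blast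
  have crs: "crossings D' = crossings D - {c, d}" by (rule crossings_del[OF D'(1)])
  note count = wcard_R2[OF bq wf(1) ne adjT adjF sign D']
  have Ne: "Ne star circ D = Ne star circ D'"
    using count[OF supported_off_True] by (intro Ne_eqI wf) simp
  have "class_at star circ D t c = class_at star circ D t d" if t: "t \<in> good star circ D" for t
  proof -
    have ok: "ok_at star circ (snd D c) t (c, False) (c, True)"
      "ok_at star circ (snd D d) t (d, False) (d, True)"
      using t mem unfolding good_def by blast+
    have S: "t \<in> states (fst D)" using t unfolding good_def by blast
    \<comment> \<open>Opposite signs make one weight (under in, over out) and the other (under out,
      over in); \<open>bigon_iff\<close> and the shared inner arcs identify these colors.\<close>
    have "wt_at (snd D c) t (c, False) (c, True) = wt_at (snd D d) t (d, False) (d, True)"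
    proof (cases dir)
      case True
      show ?thesis
        using ok s bigon_iff[OF bq s, of True "t ((c, False), False)" "t ((c, False), True)"
            "t ((c, True), False)" "t ((c, True), True)" "t ((d, False), True)" "t ((d, True), True)"]
          states_adjacentD[OF S adjT] states_adjacentD[OF S, of "(c, False)" "(d, False)"] adjF True
        unfolding ok_at_def sign by (auto simp: wt_at_def crossing_wt_def sign)
    next
      case False
      show ?thesis
        using ok s bigon_iff[OF bq s, of False "t ((d, False), False)" "t ((d, False), True)"
            "t ((c, True), False)" "t ((c, True), True)" "t ((c, False), True)" "t ((d, True), True)"]
          states_adjacentD[OF S adjT] states_adjacentD[OF S, of "(d, False)" "(c, False)"] adjF False
        unfolding ok_at_def sign by (auto simp: wt_at_def crossing_wt_def sign)
    qed
    thus ?thesis by (simp add: class_at_def)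
  qed
  hence "{t \<in> good star circ D. class_at star circ D t c = w} =
      {t \<in> good star circ D. class_at star circ D t d = w}" for w
    by auto
  hence "idx star circ D c = idx star circ D d"
    by (intro idx_eqI wf mem) simp
  show ?thesis
  proof (intro a_inv_remove[where C = "{c, d}"] Ne)
    show "idx star circ D e = idx star circ D' e" if "e \<in> crossings D'" for e
    proof (rule idx_eqI)
      fix w
      have "supported_off {c, d} (\<lambda>t. class_at star circ D t e = w)"
        using that crs by (intro supported_off_class_at) auto
      from count[OF this] show "wcard D {t \<in> good star circ D. class_at star circ D t e = w} =
          wcard D' {t \<in> good star circ D'. class_at star circ D' t e = w}"
        by (simp add: class_at_def D')
    qed (use wf that crs in auto)
    \<comment> \<open>Either both crossings have index \<open>g\<close> or neither has, and their
      signs cancel, so both sides of the balance vanish.\<close>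
    have "{e \<in> {c, d}. idx star circ D e = g} = (if idx star circ D d = g then {c, d} else {})"
      using \<open>idx star circ D c = idx star circ D d\<close> by auto
    thus "(\<Sum>e \<in> {e \<in> {c, d}. idx star circ D e = g}. snd D e) =
        (if g = Ne star circ D then \<Sum>e\<in>{c, d}. snd D e else 0)"
      using ne sign by simp
  qed (use mem crs D' in auto)
qed

section \<open>Move III and changes of representation\<close>

text \<open>The free booleans \<open>x, y\<close> fix the direction in which the under and the over
  strand are listed; True puts the entering slot first. The third move chooses them so that the
  listing follows T, M and B across the triangle.\<close>

lemma ok_at_xing:
  assumes "s = 1 \<or> s = -1"
  shows "ok_at star circ s t u ov \<longleftrightarrow> xing star circ ((s = 1) = x) ((s = 1) = y)
    (t (u, \<not> x)) (t (u, x)) (t (ov, \<not> y)) (t (ov, y))"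
  using assms unfolding ok_at_def crossing_rel_def xing_def by (cases x; cases y) auto

lemma wt_at_xing:
  assumes "s = 1 \<or> s = -1"
  shows "wt_at s t u ov = xing_wt ((s = 1) = x) ((s = 1) = y)
    (t (u, \<not> x)) (t (u, x)) (t (ov, \<not> y)) (t (ov, y))"
  using assms unfolding wt_at_def crossing_wt_def xing_wt_def by (cases x; cases y) auto

lemma R3_swap_involution [simp]: "R3_swap a b c (R3_swap a b c p) = p" if "distinct [a, b, c]"
  using that by (auto simp: R3_swap_def)

lemma fst_R3_swap: "fst (R3_swap a b c p) \<in> {a, b, c} \<longleftrightarrow> fst p \<in> {a, b, c}"
  by (auto simp: R3_swap_def)

lemma states_arc:
  assumes "t \<in> states cs" "if s then adjacent cs p q else adjacent cs q p"
  shows "t (q, \<not> s) = t (p, s)"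
  using assms(2) states_adjacentD[OF assms(1), of p q] states_adjacentD[OF assms(1), of q p]
  by (cases s) auto

text \<open>States after the move are pulled back along \<open>R3_swap\<close>, so that the two sides differ only in
  which passages meet at each crossing. The booleans \<open>x, y, z\<close> stand for sT = 1, sM = 1, sB = 1;
  they pick the slot of a passage that lies on the side of the triangle.\<close>

lemma card_R3:
  fixes star circ :: "'q::finite \<Rightarrow> 'q \<Rightarrow> 'q" and R :: "((nat \<times> bool) \<times> bool \<Rightarrow> 'q) \<Rightarrow> bool"
  assumes bq: "biquandle star circ" and dist: "distinct (concat cs)" and abc: "distinct [a, b, c]"
    and adjT: "if x then adjacent cs (a, True) (b, True) else adjacent cs (b, True) (a, True)"
    and adjM: "if y then adjacent cs (a, False) (c, True) else adjacent cs (c, True) (a, False)"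
    and adjB: "if z then adjacent cs (b, False) (c, False) else adjacent cs (c, False) (b, False)"
    and s: "sa = 1 \<or> sa = -1" "sb = 1 \<or> sb = -1" "sc = 1 \<or> sc = -1"
    and \<tau>: "((sa = 1) = y) = \<tau>" "((sb = 1) = z) = \<tau>"
    and \<mu>: "((sa = 1) = x) = \<mu>" "((sc = 1) = z) = \<mu>"
    and \<beta>: "((sb = 1) = x) = \<beta>" "((sc = 1) = y) = \<beta>"
    and R: "supported_off {a, b, c} R"
  shows "card {t \<in> states cs.
      (ok_at star circ sa t (a, False) (a, True) \<and> ok_at star circ sb t (b, False) (b, True) \<and>
       ok_at star circ sc t (c, False) (c, True)) \<and>
      P (gen_class star circ (wt_at sa t (a, False) (a, True)))
        (gen_class star circ (wt_at sb t (b, False) (b, True)))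
        (gen_class star circ (wt_at sc t (c, False) (c, True))) \<and> R t} =
    card {t \<in> states cs.
      (ok_at star circ sa t (c, True) (b, True) \<and> ok_at star circ sb t (c, False) (a, True) \<and>
       ok_at star circ sc t (b, False) (a, False)) \<and>
      P (gen_class star circ (wt_at sa t (c, True) (b, True)))
        (gen_class star circ (wt_at sb t (c, False) (a, True)))
        (gen_class star circ (wt_at sc t (b, False) (a, False))) \<and> R t}"
    (is "card ?X = card ?Y")
proof -
  let ?S = "states cs :: ((nat \<times> bool) \<times> bool \<Rightarrow> 'q) set"
  let ?cls = "gen_class star circ"
  let ?Ta = "(a, True)" and ?Tb = "(b, True)" and ?Ma = "(a, False)" and ?Mc = "(c, True)"
    and ?Bb = "(b, False)" and ?Bc = "(c, False)"
  \<comment> \<open>The outer colors are read from \<open>t\<close> and the three inner ones are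
    unknown. \<open>P\<close> belongs to the local condition and not to \<open>R\<close>, since
    weights may involve inner colors.\<close>
  define A where "A t v \<longleftrightarrow> (case v of (ti, mi, bi) \<Rightarrow>
      triangle star circ \<tau> \<mu> \<beta> (t (?Ta, \<not> x)) ti (t (?Tb, x))
        (t (?Ma, \<not> y)) mi (t (?Mc, y)) (t (?Bb, \<not> z)) bi (t (?Bc, z)) \<and>
      P (?cls (xing_wt \<tau> \<mu> (t (?Ma, \<not> y)) mi (t (?Ta, \<not> x)) ti))
        (?cls (xing_wt \<tau> \<beta> (t (?Bb, \<not> z)) bi ti (t (?Tb, x))))
        (?cls (xing_wt \<mu> \<beta> bi (t (?Bc, z)) mi (t (?Mc, y)))))"
    for t :: "(nat \<times> bool) \<times> bool \<Rightarrow> 'q" and v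
  define B where "B t v \<longleftrightarrow> (case v of (ti, mi, bi) \<Rightarrow>
      triangle star circ (\<not> \<tau>) (\<not> \<mu>) (\<not> \<beta>) (t (?Tb, x)) ti (t (?Ta, \<not> x))
        (t (?Mc, y)) mi (t (?Ma, \<not> y)) (t (?Bc, z)) bi (t (?Bb, \<not> z)) \<and>
      P (?cls (xing_wt (\<not> \<tau>) (\<not> \<mu>) (t (?Mc, y)) mi (t (?Tb, x)) ti))
        (?cls (xing_wt (\<not> \<tau>) (\<not> \<beta>) (t (?Bc, z)) bi ti (t (?Ta, \<not> x))))
        (?cls (xing_wt (\<not> \<mu>) (\<not> \<beta>) bi (t (?Bb, \<not> z)) mi (t (?Ma, \<not> y)))))"
    for t :: "(nat \<times> bool) \<times> bool \<Rightarrow> 'q" and v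
  let ?get = "\<lambda>t :: (nat \<times> bool) \<times> bool \<Rightarrow> 'q. (t (?Ta, x), t (?Ma, y), t (?Bb, z))"
  let ?put = "\<lambda>(t :: (nat \<times> bool) \<times> bool \<Rightarrow> 'q) v.
    t((?Ta, x) := fst v, (?Tb, \<not> x) := fst v, (?Ma, y) := fst (snd v), (?Mc, \<not> y) := fst (snd v),
      (?Bb, z) := snd (snd v), (?Bc, \<not> z) := snd (snd v))"
  have eq: "t (?Tb, \<not> x) = t (?Ta, x)" "t (?Mc, \<not> y) = t (?Ma, y)" "t (?Bc, \<not> z) = t (?Bb, z)"
    if "t \<in> ?S" for t
    using states_arc[OF that] adjT adjM adjB by blast+
  have neg_iff: "((S = (\<not> Q)) = (\<not> T)) = ((S = Q) = T)" for S Q T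
    by (cases S; cases Q; cases T) simp_all
  have signs: "((sa = 1) = (\<not> y)) = (\<not> \<tau>)" "((sb = 1) = (\<not> z)) = (\<not> \<tau>)"
    "((sa = 1) = (\<not> x)) = (\<not> \<mu>)" "((sc = 1) = (\<not> z)) = (\<not> \<mu>)"
    "((sb = 1) = (\<not> x)) = (\<not> \<beta>)" "((sc = 1) = (\<not> y)) = (\<not> \<beta>)"
    unfolding neg_iff by (fact \<tau> \<mu> \<beta>)+
  note slots = ok_at_xing[OF s(1), of _ _ _ ?Ma ?Ta y x] wt_at_xing[OF s(1), of _ ?Ma ?Ta y x]
    ok_at_xing[OF s(2), of _ _ _ ?Bb ?Tb z x] wt_at_xing[OF s(2), of _ ?Bb ?Tb z x]
    ok_at_xing[OF s(3), of _ _ _ ?Bc ?Mc z y] wt_at_xing[OF s(3), of _ ?Bc ?Mc z y]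
    \<comment> \<open>After the move \<open>a\<close> sits at the other end of its strands: T and M
      meet at the old places \<open>?Tb\<close> and \<open>?Mc\<close>, whose slots facing the
      triangle are the opposite ones. The same happens at \<open>b\<close> and
      \<open>c\<close>.\<close>
    ok_at_xing[OF s(1), of _ _ _ ?Mc ?Tb "\<not> y" "\<not> x"] wt_at_xing[OF s(1), of _ ?Mc ?Tb "\<not> y" "\<not> x"]
    ok_at_xing[OF s(2), of _ _ _ ?Bc ?Ta "\<not> z" "\<not> x"] wt_at_xing[OF s(2), of _ ?Bc ?Ta "\<not> z" "\<not> x"]
    ok_at_xing[OF s(3), of _ _ _ ?Bb ?Ma "\<not> z" "\<not> y"] wt_at_xing[OF s(3), of _ ?Bb ?Ma "\<not> z" "\<not> y"]
  have "?X = {t \<in> ?S. A t (?get t) \<and> R t}"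
    unfolding A_def slots \<tau> \<mu> \<beta> triangle_def prod.case
    by (rule Collect_cong, rule conj_cong[OF refl]) (simp only: eq conj_assoc)
  also have "card \<dots> = card {t \<in> ?S. B t (?get t) \<and> R t}"
  proof (rule card_local_change[where put = ?put and get = ?get and A = A and B = B])
    show "?put t v \<in> ?S" if "t \<in> ?S" for t v
      by (intro set_arc_states[OF dist] that adjT adjM adjB)
    show "?put t (?get t) = t" if "t \<in> ?S" for t
      using eq[OF that] by (simp add: fun_upd_idem)
    show "R (?put t v) = R t" for t v
      by (simp add: supported_off_upd[OF R])
    show "?put (?put t v) w = ?put t w" for t v w
      by (rule ext) simp
    show "A (?put t v) w = A t w" for t v w
      using abc by (simp add: A_def)
    show "B (?put t v) w = B t w" for t v w
      using abc by (simp add: B_def)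
    show "v = w" if "A t v" "A t w" for t v w
    proof -
      obtain v1 v2 v3 w1 w2 w3 where vw: "v = (v1, v2, v3)" "w = (w1, w2, w3)"
        by (metis prod_cases3)
      show ?thesis
        using that unfolding A_def vw prod.case prod.inject
        by (elim conjE) (intro conjI; erule (1) triangle_unique[OF bq])
    qed
    show "v = w" if "B t v" "B t w" for t v w
    proof -
      obtain v1 v2 v3 w1 w2 w3 where vw: "v = (v1, v2, v3)" "w = (w1, w2, w3)"
        by (metis prod_cases3)
      show ?thesis
        using that unfolding B_def vw prod.case prod.inject
        by (elim conjE) (intro conjI; erule (1) triangle_unique[OF bq])
    qed
    show "(\<exists>v. A t v) \<longleftrightarrow> (\<exists>v. B t v)" for t
      unfolding A_def B_def split_paired_Ex prod.case
      by (rule triangle_move_iff[OF bq]) (rule gen_class_star gen_class_circ gen_class_mixed)+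
  qed (use abc in simp)
  also have "{t \<in> ?S. B t (?get t) \<and> R t} = ?Y"
    unfolding B_def slots signs triangle_def prod.case not_not
    by (rule Collect_cong, rule conj_cong[OF refl]) (simp only: eq conj_assoc)
  finally show ?thesis .
qed

text \<open>Specializing \<open>P\<close> and \<open>R\<close> gives N, the indices of the three
  crossings, and those of all others.\<close>

lemma card_good_R3:
  fixes star circ :: "'q::finite \<Rightarrow> 'q \<Rightarrow> 'q" and R :: "((nat \<times> bool) \<times> bool \<Rightarrow> 'q) \<Rightarrow> bool"
  assumes bq: "biquandle star circ" and wf: "wf_diag D" and abc: "distinct [a, b, c]"
    and adjT: "if x then adjacent (fst D) (a, True) (b, True) else adjacent (fst D) (b, True) (a, True)"
    and adjM: "if y then adjacent (fst D) (a, False) (c, True) else adjacent (fst D) (c, True) (a, False)"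
    and adjB: "if z then adjacent (fst D) (b, False) (c, False) else adjacent (fst D) (c, False) (b, False)"
    and \<tau>: "((snd D a = 1) = y) = \<tau>" "((snd D b = 1) = z) = \<tau>"
    and \<mu>: "((snd D a = 1) = x) = \<mu>" "((snd D c = 1) = z) = \<mu>"
    and \<beta>: "((snd D b = 1) = x) = \<beta>" "((snd D c = 1) = y) = \<beta>"
    and D': "fst D' = map (map (R3_swap a b c)) (fst D)" "snd D' = snd D"
  shows "crossings D' = crossings D" and "{a, b, c} \<subseteq> crossings D"
    and "supported_off {a, b, c} R \<Longrightarrow>
      wcard D {t \<in> good star circ D. P (class_at star circ D t a)
        (class_at star circ D t b) (class_at star circ D t c) \<and> R t} =
      wcard D' {t \<in> good star circ D'. P (class_at star circ D' t a)
        (class_at star circ D' t b) (class_at star circ D' t c) \<and> R t}"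
proof -
  let ?\<pi> = "R3_swap a b c" and ?P = "set (concat (fst D))"
  have "e \<in> crossings D \<and> e' \<in> crossings D" if "adjacent (fst D) (e, s) (e', s')" for e e' s s'
    using adjacent_in_passages[OF that] wf_diag_passage_iff[OF wf] by blast
  thus abc_in: "{a, b, c} \<subseteq> crossings D"
    using adjT adjM by (metis empty_subsetI insert_subset)
  have \<pi>_P: "?\<pi> p \<in> ?P \<longleftrightarrow> p \<in> ?P" for p
  proof (cases "fst p \<in> {a, b, c}")
    case True
    hence "fst p \<in> crossings D" "fst (?\<pi> p) \<in> crossings D"
      using abc_in fst_R3_swap[of a b c p] by blast+
    thus ?thesis using wf_diag_passage_iff[OF wf] by (metis prod.collapse)
  next
    case False
    hence "?\<pi> p = p" by (auto simp: R3_swap_def)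
    thus ?thesis by simp
  qed
  have P': "set (concat (fst D')) = ?P"
  proof -
    have "set (concat (fst D')) = ?\<pi> ` ?P" unfolding D' by auto
    also have "\<dots> = ?P"
    proof (intro equalityI subsetI)
      fix p assume "p \<in> ?P"
      moreover have "p = ?\<pi> (?\<pi> p)" using abc by simp
      ultimately show "p \<in> ?\<pi> ` ?P" using \<pi>_P[of p] by (intro image_eqI[of p ?\<pi> "?\<pi> p"]) simp_all
    next
      fix p assume "p \<in> ?\<pi> ` ?P"
      thus "p \<in> ?P" using \<pi>_P by (elim imageE) (simp only:)
    qed
    finally show ?thesis .
  qed
  show crs: "crossings D' = crossings D" unfolding crossings_def P' ..
  assume R: "supported_off {a, b, c} R"
  define R' where "R' t \<longleftrightarrow>
    (\<forall>d \<in> crossings D - {a, b, c}. ok_at star circ (snd D d) t (d, False) (d, True)) \<and> R t" for t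
  have R': "supported_off {a, b, c} R'"
    unfolding R'_def using R by (intro supported_off_conj supported_off_ok_at) auto
  have split: "(\<forall>d \<in> crossings D. Q d) \<longleftrightarrow>
      (Q a \<and> Q b \<and> Q c) \<and> (\<forall>d \<in> crossings D - {a, b, c}. Q d)" for Q
    using abc_in by blast
  have s: "snd D a = 1 \<or> snd D a = -1" "snd D b = 1 \<or> snd D b = -1" "snd D c = 1 \<or> snd D c = -1"
    using wf abc_in unfolding wf_diag_def by blast+
  let ?X = "{t \<in> good star circ D. P (class_at star circ D t a)
        (class_at star circ D t b) (class_at star circ D t c) \<and> R t}"
  let ?X' = "{t \<in> good star circ D'. P (class_at star circ D' t a)
        (class_at star circ D' t b) (class_at star circ D' t c) \<and> R t}"
  let ?C = "\<lambda>ua va ub vb uc vc t. (ok_at star circ (snd D a) t ua va \<and>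
      ok_at star circ (snd D b) t ub vb \<and> ok_at star circ (snd D c) t uc vc) \<and>
    P (gen_class star circ (wt_at (snd D a) t ua va)) (gen_class star circ (wt_at (snd D b) t ub vb))
      (gen_class star circ (wt_at (snd D c) t uc vc)) \<and> R' t"
  let ?before = "?C (a, False) (a, True) (b, False) (b, True) (c, False) (c, True)"
    and ?after = "?C (c, True) (b, True) (c, False) (a, True) (b, False) (a, False)"
  have 1: "?X = {t \<in> states (fst D). ?before t}"
    unfolding good_def R'_def class_at_def split by auto
  have 2: "card {t \<in> states (fst D). ?before t} = card {t \<in> states (fst D). ?after t}"
    by (rule card_R3[OF bq wf_diag_distinct[OF wf] abc adjT adjM adjB s \<tau> \<mu> \<beta> R'])
  \<comment> \<open>The moved diagram has the same labels and signs, so its conditions read like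
    \<open>?before\<close>; seen through \<open>R3_swap\<close> on the old diagram they become
    \<open>?after\<close>.\<close>
  have 3: "card {t \<in> states (map (map ?\<pi>) (fst D)). ?before t} = card {t \<in> states (fst D). ?after t}"
  proof (rule card_pull)
    show "inj_on ?\<pi> ?P" by (rule inj_on_inverseI[where g = ?\<pi>]) (use abc in simp)
    fix t :: "(nat \<times> bool) \<times> bool \<Rightarrow> 'q" assume "t \<in> states (map (map ?\<pi>) (fst D))"
    hence t: "t \<in> extensional (?P \<times> UNIV)" using P' unfolding D' states_def by simp
    have pull: "t (p, s) = pull ?\<pi> (fst D) t (?\<pi> p, s)" if "p \<in> ?P" for p s
      using that \<pi>_P[of p] pull_apply[of "?\<pi> p" "fst D" ?\<pi> t s] abc by simp
    have "(e, ov) \<in> ?P" if "e \<in> {a, b, c}" for e ov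
      using that abc_in wf_diag_passage_iff[OF wf] by blast
    hence pulls: "t ((a, True), s) = pull ?\<pi> (fst D) t ((b, True), s)"
      "t ((a, False), s) = pull ?\<pi> (fst D) t ((c, True), s)"
      "t ((b, True), s) = pull ?\<pi> (fst D) t ((a, True), s)"
      "t ((b, False), s) = pull ?\<pi> (fst D) t ((c, False), s)"
      "t ((c, True), s) = pull ?\<pi> (fst D) t ((a, False), s)"
      "t ((c, False), s) = pull ?\<pi> (fst D) t ((b, False), s)" for s
      using pull[of "(a, True)" s] pull[of "(a, False)" s] pull[of "(b, True)" s]
        pull[of "(b, False)" s] pull[of "(c, True)" s] pull[of "(c, False)" s] abc
      by (simp_all add: R3_swap_def)
    have "t ((e, ov), s) = pull ?\<pi> (fst D) t ((e, ov), s)" if "e \<notin> {a, b, c}" for e ov s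
    proof -
      have "?\<pi> (e, ov) = (e, ov)" using that by (auto simp: R3_swap_def)
      thus ?thesis
        using pull[of "(e, ov)" s] t by (cases "(e, ov) \<in> ?P") (auto simp: pull_def extensional_def)
    qed
    hence "R' t = R' (pull ?\<pi> (fst D) t)"
      using R' unfolding supported_off_def by blast
    thus "?before t = ?after (pull ?\<pi> (fst D) t)"
      unfolding ok_at_def wt_at_def by (simp only: pulls)
  qed
  have 4: "?X' = {t \<in> states (map (map ?\<pi>) (fst D)). ?before t}"
    unfolding good_def R'_def class_at_def crs D' split by auto
  show "wcard D ?X = wcard D' ?X'"
    unfolding 1 4 wcard_def D' loops_map 2 3 ..
qed

lemma a_inv_R3:
  fixes star circ :: "'q::finite \<Rightarrow> 'q \<Rightarrow> 'q"
  assumes bq: "biquandle star circ" and wf: "wf_diag D" "wf_diag D'" and "R3_move D D'"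
  shows "a_inv star circ g D = a_inv star circ g D'"
proof -
  obtain a b c and sT sM sB \<Delta> :: int where abc: "distinct [a, b, c]"
    and pm: "sT \<in> {1, -1}" "sM \<in> {1, -1}" "sB \<in> {1, -1}" "\<Delta> \<in> {1, -1}"
    and adj: "if sT = 1 then adjacent (fst D) (a, True) (b, True) else adjacent (fst D) (b, True) (a, True)"
      "if sM = 1 then adjacent (fst D) (a, False) (c, True) else adjacent (fst D) (c, True) (a, False)"
      "if sB = 1 then adjacent (fst D) (b, False) (c, False) else adjacent (fst D) (c, False) (b, False)"
    and s: "snd D a = sT * sM * \<Delta>" "snd D b = sT * sB * \<Delta>" "snd D c = sM * sB * \<Delta>"
    and D': "fst D' = map (map (R3_swap a b c)) (fst D)" "snd D' = snd D"
    using \<open>R3_move D D'\<close> unfolding R3_move_def by blast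
  \<comment> \<open>All factors are 1 or -1, so multiplying the sign of a crossing by the direction
    of one strand leaves the direction of the other times \<Delta>. This value is the same at both
    crossings of that other strand.\<close>
  have signs: "((snd D a = 1) = (sM = 1)) = (sT * \<Delta> = 1)" "((snd D b = 1) = (sB = 1)) = (sT * \<Delta> = 1)"
    "((snd D a = 1) = (sT = 1)) = (sM * \<Delta> = 1)" "((snd D c = 1) = (sB = 1)) = (sM * \<Delta> = 1)"
    "((snd D b = 1) = (sT = 1)) = (sB * \<Delta> = 1)" "((snd D c = 1) = (sM = 1)) = (sB * \<Delta> = 1)"
    unfolding s using pm by auto
  note * = card_good_R3[OF bq wf(1) abc adj signs D']
  have crs: "crossings D' = crossings D" by (rule *(1))
  have idx: "idx star circ D d = idx star circ D' d" if d: "d \<in> crossings D" for d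
  proof (rule idx_eqI)
    fix w
    consider "d = a" | "d = b" | "d = c" | "d \<notin> {a, b, c}" by blast
    thus "wcard D {t \<in> good star circ D. class_at star circ D t d = w} =
        wcard D' {t \<in> good star circ D'. class_at star circ D' t d = w}"
    proof cases
      case 1
      thus ?thesis using *(3)[of "\<lambda>_. True" "\<lambda>u _ _. u = w"] by (simp add: supported_off_True)
    next
      case 2
      thus ?thesis using *(3)[of "\<lambda>_. True" "\<lambda>_ u _. u = w"] by (simp add: supported_off_True)
    next
      case 3
      thus ?thesis using *(3)[of "\<lambda>_. True" "\<lambda>_ _ u. u = w"] by (simp add: supported_off_True)
    next
      case 4
      have "class_at star circ D' t d = class_at star circ D t d" for t
        by (simp add: class_at_def D')
      thus ?thesis
        using *(3)[OF supported_off_class_at[OF 4, of star circ D w], of "\<lambda>_ _ _. True"] by simp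
    qed
  qed (use wf d crs in auto)
  show ?thesis
  proof (rule a_inv_eqI[where h = id])
    show "Ne star circ D = Ne star circ D'"
      using *(3)[of "\<lambda>_. True" "\<lambda>_ _ _. True"] by (intro Ne_eqI wf) (simp add: supported_off_True)
  qed (use crs D' idx in auto)
qed

text \<open>States see a diagram only through its passages, their adjacency and the number of empty
  components. Rotating a component or permuting components preserves these although the numbering of
  semiarcs changes.\<close>

lemma a_inv_cong:
  fixes star circ :: "'q::finite \<Rightarrow> 'q \<Rightarrow> 'q"
  assumes wf: "wf_diag D" "wf_diag D'"
    and passages: "set (concat (fst D')) = set (concat (fst D))"
    and adj: "\<And>p q. adjacent (fst D') p q = adjacent (fst D) p q"
    and loops: "loops (fst D') = loops (fst D)" and signs: "snd D' = snd D"
  shows "a_inv star circ g D = a_inv star circ g D'"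
proof -
  have crs: "crossings D' = crossings D" unfolding crossings_def passages ..
  have good: "good star circ D' = good star circ D"
    unfolding good_def states_def crs signs adj passages ..
  have wcard: "wcard D' T = wcard D T" for T :: "((nat \<times> bool) \<times> bool \<Rightarrow> 'q) set"
    by (simp add: wcard_def loops)
  show ?thesis
  proof (rule a_inv_eqI[where h = id])
    show "Ne star circ D = Ne star circ D'"
      by (intro Ne_eqI wf) (simp add: good wcard)
    show "idx star circ D c = idx star circ D' (id c)" if "c \<in> crossings D" for c
      by (rule idx_eqI) (use wf that in \<open>simp_all add: crs good wcard class_at_def signs\<close>)
  qed (simp_all add: crs signs)
qed

lemma a_inv_relabel:
  fixes star circ :: "'q::finite \<Rightarrow> 'q \<Rightarrow> 'q"
  assumes wf: "wf_diag D" "wf_diag D'"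
    and inj: "inj_on f (crossings D)"
    and signs: "\<And>c. c \<in> crossings D \<Longrightarrow> snd D' (f c) = snd D c"
    and D': "fst D' = map (map (\<lambda>(c, ov). (f c, ov))) (fst D)"
  shows "a_inv star circ g D = a_inv star circ g D'"
proof -
  let ?f = "\<lambda>(c, ov :: bool). (f c, ov)"
  have crs: "crossings D' = f ` crossings D"
    unfolding crossings_def D' by (force simp: image_iff)
  have inj': "inj_on ?f (set (concat (fst D)))"
    using inj wf_diag_passage_iff[OF wf(1)] unfolding inj_on_def by fast
  have pull: "t ((f c, ov), s) = pull ?f (fst D) t ((c, ov), s)" if "c \<in> crossings D" for t c ov s
    using that wf_diag_passage_iff[OF wf(1)] by (simp add: pull_apply del: set_concat)
  have ok: "(\<forall>c \<in> crossings D'. ok_at star circ (snd D' c) t (c, False) (c, True)) \<longleftrightarrow>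
      (\<forall>c \<in> crossings D. ok_at star circ (snd D c) (pull ?f (fst D) t) (c, False) (c, True))"
    for t :: "(nat \<times> bool) \<times> bool \<Rightarrow> 'q"
    unfolding crs ball_simps by (rule ball_cong) (simp_all add: ok_at_def signs pull)
  have count: "wcard D' {t \<in> good star circ D'. R' t} = wcard D {t \<in> good star circ D. R t}"
    if "\<And>t. R' t = R (pull ?f (fst D) t)" for R R' :: "((nat \<times> bool) \<times> bool \<Rightarrow> 'q) \<Rightarrow> bool"
  proof -
    have "card {t \<in> states (map (map ?f) (fst D)).
        (\<forall>c \<in> crossings D'. ok_at star circ (snd D' c) t (c, False) (c, True)) \<and> R' t} =
      card {t \<in> states (fst D).
        (\<forall>c \<in> crossings D. ok_at star circ (snd D c) t (c, False) (c, True)) \<and> R t}"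
      by (rule card_pull[OF inj']) (simp only: ok that)
    thus ?thesis by (simp add: wcard_def good_def D' conj_assoc)
  qed
  show ?thesis
  proof (rule a_inv_eqI[where h = f])
    show "bij_betw f (crossings D) (crossings D')" using inj crs by (simp add: bij_betw_def)
    show "Ne star circ D = Ne star circ D'"
      using count[of "\<lambda>_. True" "\<lambda>_. True"] by (intro Ne_eqI wf) simp
    show "idx star circ D c = idx star circ D' (f c)" if c: "c \<in> crossings D" for c
    proof (rule idx_eqI)
      fix w
      show "wcard D {t \<in> good star circ D. class_at star circ D t c = w} =
          wcard D' {t \<in> good star circ D'. class_at star circ D' t (f c) = w}"
        by (rule count[symmetric]) (use c in \<open>simp add: class_at_def wt_at_def signs pull\<close>)
    qed (use wf c crs in auto)
  qed (rule signs)
qed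

lemma a_inv_iso:
  fixes star circ :: "'q::finite \<Rightarrow> 'q \<Rightarrow> 'q"
  assumes wf: "wf_diag D" "wf_diag D'" and "iso_move D D'"
  shows "a_inv star circ g D = a_inv star circ g D'"
  using \<open>iso_move D D'\<close> unfolding iso_move_def
proof (elim disjE exE conjE)
  fix f assume "inj_on f (crossings D)" "\<forall>c \<in> crossings D. snd D' (f c) = snd D c"
    "fst D' = map (map (\<lambda>(c, ov). (f c, ov))) (fst D)"
  thus ?thesis using a_inv_relabel[OF wf] by blast
next
  fix k n assume k: "k < length (fst D)" and D': "fst D' = (fst D)[k := rotate n (fst D ! k)]"
    and signs: "snd D' = snd D"
  \<comment> \<open>Applied below to the rotation-invariant data \<open>set\<close>,
    \<open>cyc_pairs\<close> and emptiness of a component.\<close>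
  have map_eq: "map F (fst D') = map F (fst D)" if "\<And>xs. F (rotate n xs) = F xs"
    for F :: "(nat \<times> bool) list \<Rightarrow> 'b"
    using k by (simp add: D' map_update that list_update_same_conv)
  have img: "F ` set (fst D') = F ` set (fst D)" if "\<And>xs. F (rotate n xs) = F xs"
    for F :: "(nat \<times> bool) list \<Rightarrow> 'b"
    using map_eq[of F] that by (metis set_map)
  show ?thesis
  proof (rule a_inv_cong[OF wf _ _ _ signs])
    show "set (concat (fst D')) = set (concat (fst D))"
      using img[of set] by (simp only: set_concat set_rotate)
    have "cyc_pairs ` set (fst D') = cyc_pairs ` set (fst D)" by (rule img) simp
    thus "adjacent (fst D') p q = adjacent (fst D) p q" for p q
      unfolding adjacent_iff_cyc_pairs by (metis (no_types, lifting) imageE image_eqI)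
    have loops_alt: "loops cs = length (filter id (map (\<lambda>xs. xs = []) cs))"
      for cs :: "(nat \<times> bool) list list"
      by (simp add: loops_def filter_map o_def)
    have "map (\<lambda>xs. xs = []) (fst D') = map (\<lambda>xs. xs = []) (fst D)"
      by (rule map_eq) simp
    thus "loops (fst D') = loops (fst D)" by (simp only: loops_alt)
  qed
next
  assume perm: "mset (fst D') = mset (fst D)" and signs: "snd D' = snd D"
  have set: "set (fst D') = set (fst D)" using perm by (metis set_mset_mset)
  show ?thesis
  proof (rule a_inv_cong[OF wf _ _ _ signs])
    have "mset (filter (\<lambda>xs. xs = []) (fst D')) = mset (filter (\<lambda>xs. xs = []) (fst D))"
      using perm by simp
    thus "loops (fst D') = loops (fst D)" unfolding loops_def by (rule mset_eq_length)
  qed (simp_all add: set adjacent_iff_cyc_pairs)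
qed

theorem theorem6p3:
  fixes star circ :: "'q::finite \<Rightarrow> 'q \<Rightarrow> 'q"
    and g :: "'q gword set \<Rightarrow>\<^sub>0 int"
    and L L' :: vdiag
  assumes "biquandle star circ"
    and "Poly_Mapping.keys g \<subseteq> range (gclass star circ)"
    and "wf_diag L" and "wf_diag L'"
    and "vequiv L L'"
  shows "a_inv star circ g L = a_inv star circ g L'"
proof -
  have move: "a_inv star circ g D = a_inv star circ g D'"
    if "wf_diag D \<and> wf_diag D' \<and> (iso_move D D' \<or> R1_move D D' \<or> R2_move D D' \<or> R3_move D D')"
    for D D'
    using that a_inv_iso a_inv_R1[OF assms(1)] a_inv_R2[OF assms(1)] a_inv_R3[OF assms(1)] by metis
  show ?thesis
    using assms(5) unfolding vequiv_def
  proof (induction rule: equivclp_induct)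
    case base
    show ?case ..
  next
    case (step D D')
    \<comment> \<open>A step of the equivalence closure may run against the move, hence the two
      instances.\<close>
    thus ?case using move[of D D'] move[of D' D] by argo
  qed
qed

end
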